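(* There exist an absolute constant $c$ (independent of $n$) and universal polynomials $C_0=C_0(n)>0$, $C=C(n)>0$ such that the following holds. Let $\boldsymbol{A}\in\mathbb{R}^{n\times n}$ be invertible with rows $\boldsymbol{a}_1^\top,\dots,\boldsymbol{a}_n^\top$, let $\boldsymbol{b}\in\mathbb{R}^n$, and let $\boldsymbol{x}:=\boldsymbol{A}^{-1}\boldsymbol{b}$. Let $\widehat{\boldsymbol{x}}_k$ be the output of $k$ iterations of (regularized) accelerated randomized Kaczmarz (ARK) with initialization $\boldsymbol{v}_0=\boldsymbol{y}_0=\boldsymbol{0}$, executed in floating-point arithmetic with unit roundoff $u$, with parameters $$\tilde\mu=\frac{\sigma_{\min}^2(\boldsymbol{A})}{\|\boldsymbol{A}\|_{\rm F}^2+n\lambda},\qquad \tilde\nu=\frac{\|\boldsymbol{A}\|_{\rm F}^2+n\lambda}{\min_i\|\boldsymbol{a}_i\|^2+\lambda},$$ where one of the following two options holds: (1) $\lambda=\|\boldsymbol{A}\|_{\rm F}^2/n$; or (2) $\lambda=0$ and $4\min_i\|\boldsymbol{a}_i\|^2\ge\max_i\|\boldsymbol{a}_i\|^2$. Assume $\tilde\kappa(\boldsymbol{A})^2u\ll1$, i.e. $\tilde\kappa(\boldsymbol{A})^2u\le 1/C_0(n)$. Then $$\mathbb{E}\,\|\widehat{\boldsymbol{x}}_k-\boldsymbol{x}\|\le\left(1-\frac{1}{4\tilde\kappa(\boldsymbol{A})\sqrt n}\right)^{k/4}c\,\|\boldsymbol{x}\|+C\,\|\boldsymbol{x}\|\,\tilde\kappa(\boldsymbol{A})^2u.$$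 In particular, when the method is run for a suitable number $k=\mathcal{O}(\tilde\kappa(\boldsymbol{A})\sqrt n\log(1/u))$ of iterations (absolute implied constant), the output satisfies $$\mathbb{E}\,\|\widehat{\boldsymbol{x}}_k-\boldsymbol{x}\|\lesssim\|\boldsymbol{x}\|\,\tilde\kappa(\boldsymbol{A})^2u.$$
   Context: Norms: $\|\cdot\|$ is the vector $\ell_2$ norm and its induced operator norm; $\|\cdot\|_{\rm F}$ is the Frobenius norm; $\sigma_{\min}$ is the smallest singular value. The Demmel condition number is $\tilde\kappa(\boldsymbol{A})=\|\boldsymbol{A}\|_{\rm F}\|\boldsymbol{A}^{-1}\|$. Asymptotic notation: $a\lesssim b$ means $a\le C(n)b$ for a fixed universal (unspecified) polynomial $C(n)>0$; $a\ll b$ means $a\le b/C(n)$ for a sufficiently large universal polynomial $C(n)>0$. ARK for $\boldsymbol{A}\boldsymbol{x}=\boldsymbol{b}$ with parameters $\tilde\mu,\tilde\nu>0$, $\lambda\ge0$: set $\beta=1-\sqrt{\tilde\mu/\tilde\nu}$, $\gamma=1/\sqrt{\tilde\mu\tilde\nu}$, $\alpha=1/(1+\gamma\tilde\nu)$. Given $\boldsymbol{v}_0,\boldsymbol{y}_0$, iteration $k=0,1,2,\dots$ is: $$\boldsymbol{x}_k=\alpha\boldsymbol{v}_k+(1-\alpha)\boldsymbol{y}_k;$$ draw (independently of the past) $r(k)\in\{1,\dots,n\}$ with $\Pr[r(k)=i]=\frac{\|\boldsymbol{a}_i\|^2+\lambda}{\|\boldsymbol{A}\|_{\rm F}^2+n\lambda}$;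 $$\boldsymbol{w}_k=\frac{\langle\boldsymbol{a}_{r(k)},\boldsymbol{x}_k\rangle-b_{r(k)}}{\|\boldsymbol{a}_{r(k)}\|^2+\lambda}\boldsymbol{a}_{r(k)},\quad \boldsymbol{y}_{k+1}=\boldsymbol{x}_k-\boldsymbol{w}_k,\quad \boldsymbol{v}_{k+1}=\beta\boldsymbol{v}_k+(1-\beta)\boldsymbol{x}_k-\gamma\boldsymbol{w}_k.$$ The output after $k$ iterations is $\boldsymbol{x}_k=\alpha\boldsymbol{v}_k+(1-\alpha)\boldsymbol{y}_k$. Hats denote the quantities computed when all these steps are carried out in floating-point arithmetic in the natural way. The expectation is over the random row indices. Floating-point model (standard model, unit roundoff $u$, no overflow/underflow): the rounding function $\mathrm{fl}$ satisfies $|\mathrm{fl}(x)-x|\le u|x|$ for all $x\in\mathbb{R}$, and for exactly represented scalars $a,b$ and $\mathrm{op}\in\{+,-,\times,\div\}$ the computed value of $a\,\mathrm{op}\,b$ differs from $a\,\mathrm{op}\,b$ by at most $u\,|a\,\mathrm{op}\,b|$. Vector operations, inner products and matrix–vector products are computed by the standard routines from these scalar operations. The entries of $\boldsymbol{A}$, $\boldsymbol{b}$ and the scalar parameters of the method (including $\alpha,1-\alpha,\beta,1-\beta,\gamma,\lambda$) are exactly represented, and row indices are sampled with the stated probabilities. *)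

theory Defs
  imports
    "HOL-Probability.Probability_Mass_Function"
    "HOL-Computational_Algebra.Polynomial"
    "Jordan_Normal_Form.Gauss_Jordan_Elimination"
    "Jordan_Normal_Form.Char_Poly"
begin

(* Rows, columns and vector entries are indexed from 0, so the row indices of an
   n x n matrix are {..<n}.  Matrices with explicit carriers are used because the
   dimension n has to be quantified inside the statement. *)

section \<open>Norms, singular values, condition number\<close>

definition l2_norm :: "real vec \<Rightarrow> real" where
  "l2_norm v = sqrt (v \<bullet> v)"

definition fro_norm :: "real mat \<Rightarrow> real" where
  "fro_norm A = sqrt (\<Sum>i<dim_row A. \<Sum>j<dim_col A. (A $$ (i, j))\<^sup>2)"

definition spectral_norm :: "real mat \<Rightarrow> real" where
  "spectral_norm A = Sup {l2_norm (A *\<^sub>v z) | z. z \<in> carrier_vec (dim_col A) \<and> l2_norm z = 1}"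

definition singular_values :: "real mat \<Rightarrow> real set" where
  "singular_values A = {s. 0 \<le> s \<and> eigenvalue (A\<^sup>T * A) (s\<^sup>2)}"

definition sigma_min :: "real mat \<Rightarrow> real" where
  "sigma_min A = Min (singular_values A)"

(* mat_inverse returns None exactly on singular (or non-square) matrices *)
definition mat_inv :: "real mat \<Rightarrow> real mat" where
  "mat_inv A = the (mat_inverse A)"

definition demmel_cond :: "real mat \<Rightarrow> real" where
  "demmel_cond A = fro_norm A * spectral_norm (mat_inv A)"

definition row_sq :: "real mat \<Rightarrow> nat \<Rightarrow> real" where
  "row_sq A i = (l2_norm (row A i))\<^sup>2"

definition min_row_sq :: "real mat \<Rightarrow> real" where
  "min_row_sq A = Min (row_sq A ` {..<dim_row A})"

definition max_row_sq :: "real mat \<Rightarrow> real" where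
  "max_row_sq A = Max (row_sq A ` {..<dim_row A})"

section \<open>Floating-point arithmetic\<close>

(* fp_repr is the set of exactly represented numbers; the operations are only
   constrained on represented arguments. *)
record fp_arith =
  fp_repr :: "real set"
  fp_round :: "real \<Rightarrow> real"
  fp_add :: "real \<Rightarrow> real \<Rightarrow> real"
  fp_sub :: "real \<Rightarrow> real \<Rightarrow> real"
  fp_mul :: "real \<Rightarrow> real \<Rightarrow> real"
  fp_div :: "real \<Rightarrow> real \<Rightarrow> real"

definition standard_model :: "fp_arith \<Rightarrow> real \<Rightarrow> bool" where
  "standard_model M u \<longleftrightarrow>
     0 < u \<and>
     (\<forall>x. fp_round M x \<in> fp_repr M \<and> \<bar>fp_round M x - x\<bar> \<le> u * \<bar>x\<bar>) \<and>
     (\<forall>a\<in>fp_repr M. \<forall>b\<in>fp_repr M.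
        fp_add M a b \<in> fp_repr M \<and> \<bar>fp_add M a b - (a + b)\<bar> \<le> u * \<bar>a + b\<bar> \<and>
        fp_sub M a b \<in> fp_repr M \<and> \<bar>fp_sub M a b - (a - b)\<bar> \<le> u * \<bar>a - b\<bar> \<and>
        fp_mul M a b \<in> fp_repr M \<and> \<bar>fp_mul M a b - a * b\<bar> \<le> u * \<bar>a * b\<bar> \<and>
        (b \<noteq> 0 \<longrightarrow> fp_div M a b \<in> fp_repr M \<and> \<bar>fp_div M a b - a / b\<bar> \<le> u * \<bar>a / b\<bar>))"

definition fp_vec_add :: "fp_arith \<Rightarrow> real vec \<Rightarrow> real vec \<Rightarrow> real vec" where
  "fp_vec_add M x y = vec (dim_vec x) (\<lambda>i. fp_add M (x $ i) (y $ i))"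

definition fp_vec_sub :: "fp_arith \<Rightarrow> real vec \<Rightarrow> real vec \<Rightarrow> real vec" where
  "fp_vec_sub M x y = vec (dim_vec x) (\<lambda>i. fp_sub M (x $ i) (y $ i))"

definition fp_scale :: "fp_arith \<Rightarrow> real \<Rightarrow> real vec \<Rightarrow> real vec" where
  "fp_scale M t x = map_vec (fp_mul M t) x"

(* recursive summation from left to right, started with the first product *)
primrec fp_dot_prefix :: "fp_arith \<Rightarrow> real vec \<Rightarrow> real vec \<Rightarrow> nat \<Rightarrow> real" where
  "fp_dot_prefix M x y 0 = fp_mul M (x $ 0) (y $ 0)"
| "fp_dot_prefix M x y (Suc i) =
     fp_add M (fp_dot_prefix M x y i) (fp_mul M (x $ Suc i) (y $ Suc i))"

(* for vectors of positive dimension *)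
definition fp_dot :: "fp_arith \<Rightarrow> real vec \<Rightarrow> real vec \<Rightarrow> real" where
  "fp_dot M x y = fp_dot_prefix M x y (dim_vec x - 1)"

section \<open>Accelerated randomized Kaczmarz\<close>

definition ark_beta :: "real \<Rightarrow> real \<Rightarrow> real" where
  "ark_beta \<mu> \<nu> = 1 - sqrt (\<mu> / \<nu>)"

definition ark_gamma :: "real \<Rightarrow> real \<Rightarrow> real" where
  "ark_gamma \<mu> \<nu> = 1 / sqrt (\<mu> * \<nu>)"

definition ark_alpha :: "real \<Rightarrow> real \<Rightarrow> real" where
  "ark_alpha \<mu> \<nu> = 1 / (1 + ark_gamma \<mu> \<nu> * \<nu>)"

definition ark_row_pmf :: "real mat \<Rightarrow> real \<Rightarrow> nat pmf" where
  "ark_row_pmf A lam = embed_pmf (\<lambda>i. if i < dim_row A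
     then (row_sq A i + lam) / ((fro_norm A)\<^sup>2 + real (dim_row A) * lam) else 0)"

lemma sum_row_sq: "(\<Sum>i<dim_row A. row_sq A i) = (fro_norm A)\<^sup>2"
proof -
  have "row_sq A i = (\<Sum>j<dim_col A. (A $$ (i, j))\<^sup>2)" if "i < dim_row A" for i
  proof -
    have "row A i \<bullet> row A i = (\<Sum>j<dim_col A. (A $$ (i, j))\<^sup>2)"
      using that by (simp add: scalar_prod_def power2_eq_square lessThan_atLeast0)
    moreover have "(\<Sum>j<dim_col A. (A $$ (i, j))\<^sup>2) \<ge> 0"
      by (intro sum_nonneg) simp
    ultimately show ?thesis
      by (simp add: row_sq_def l2_norm_def)
  qed
  moreover have "(\<Sum>i<dim_row A. \<Sum>j<dim_col A. (A $$ (i, j))\<^sup>2) \<ge> 0"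
    by (intro sum_nonneg) simp
  ultimately show ?thesis
    by (simp add: fro_norm_def)
qed

(* embed_pmf is total; this shows that it yields the intended distribution here *)
lemma pmf_ark_row_pmf:
  assumes "0 \<le> lam" and "0 < (fro_norm A)\<^sup>2 + real (dim_row A) * lam"
  shows "pmf (ark_row_pmf A lam) i = (if i < dim_row A
     then (row_sq A i + lam) / ((fro_norm A)\<^sup>2 + real (dim_row A) * lam) else 0)"
proof -
  let ?S = "(fro_norm A)\<^sup>2 + real (dim_row A) * lam"
  let ?f = "\<lambda>i. if i < dim_row A then (row_sq A i + lam) / ?S else 0"
  have nn: "0 \<le> ?f i" for i
    using assms by (simp add: row_sq_def)
  have "(\<integral>\<^sup>+i. ennreal (?f i) \<partial>count_space UNIV) = (\<Sum>i<dim_row A. ennreal (?f i))"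
    by (rule nn_integral_count_space'[where A = "{..<dim_row A}"]) auto
  also have "\<dots> = ennreal (\<Sum>i<dim_row A. ?f i)"
    by (intro sum_ennreal nn)
  also have "(\<Sum>i<dim_row A. ?f i) = (\<Sum>i<dim_row A. row_sq A i + lam) / ?S"
    by (simp add: sum_divide_distrib)
  also have "\<dots> = 1"
    using assms(2) by (simp add: sum.distrib sum_row_sq)
  finally show ?thesis
    unfolding ark_row_pmf_def using nn by (subst pmf_embed_pmf) auto
qed

(* computed version of x_k = alpha v_k + (1 - alpha) y_k; the scalars alpha, 1 - alpha,
   beta, 1 - beta and gamma are exact, not computed *)
definition fp_ark_x :: "fp_arith \<Rightarrow> real \<Rightarrow> real \<Rightarrow> real vec \<times> real vec \<Rightarrow> real vec" where
  "fp_ark_x M \<mu> \<nu> = (\<lambda>(v, y).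
     fp_vec_add M (fp_scale M (ark_alpha \<mu> \<nu>) v) (fp_scale M (1 - ark_alpha \<mu> \<nu>) y))"

(* one computed iteration (v_k, y_k) |-> (v_{k+1}, y_{k+1}) with row index r *)
definition fp_ark_step ::
  "fp_arith \<Rightarrow> real mat \<Rightarrow> real vec \<Rightarrow> real \<Rightarrow> real \<Rightarrow> real \<Rightarrow> nat \<Rightarrow>
   real vec \<times> real vec \<Rightarrow> real vec \<times> real vec" where
  "fp_ark_step M A b lam \<mu> \<nu> r = (\<lambda>(v, y).
     let x = fp_ark_x M \<mu> \<nu> (v, y);
         a = row A r;
         t = fp_div M (fp_sub M (fp_dot M a x) (b $ r)) (fp_add M (fp_dot M a a) lam);
         w = fp_scale M t a;
         y' = fp_vec_sub M x w;
         v' = fp_vec_sub M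
                (fp_vec_add M (fp_scale M (ark_beta \<mu> \<nu>) v) (fp_scale M (1 - ark_beta \<mu> \<nu>) x))
                (fp_scale M (ark_gamma \<mu> \<nu>) w)
     in (v', y'))"

(* joint law of the computed pair (v_k, y_k), started from v_0 = y_0 = 0; the monadic
   bind draws each row index independently of the past *)
primrec fp_ark_state ::
  "fp_arith \<Rightarrow> real mat \<Rightarrow> real vec \<Rightarrow> real \<Rightarrow> real \<Rightarrow> real \<Rightarrow> nat \<Rightarrow> (real vec \<times> real vec) pmf" where
  "fp_ark_state M A b lam \<mu> \<nu> 0 = return_pmf (0\<^sub>v (dim_col A), 0\<^sub>v (dim_col A))"
| "fp_ark_state M A b lam \<mu> \<nu> (Suc k) =
     bind_pmf (fp_ark_state M A b lam \<mu> \<nu> k)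
       (\<lambda>s. map_pmf (\<lambda>r. fp_ark_step M A b lam \<mu> \<nu> r s) (ark_row_pmf A lam))"

definition fp_ark_output ::
  "fp_arith \<Rightarrow> real mat \<Rightarrow> real vec \<Rightarrow> real \<Rightarrow> real \<Rightarrow> real \<Rightarrow> nat \<Rightarrow> real vec pmf" where
  "fp_ark_output M A b lam \<mu> \<nu> k = map_pmf (fp_ark_x M \<mu> \<nu>) (fp_ark_state M A b lam \<mu> \<nu> k)"

definition ark_mu :: "real mat \<Rightarrow> real \<Rightarrow> real" where
  "ark_mu A lam = (sigma_min A)\<^sup>2 / ((fro_norm A)\<^sup>2 + real (dim_row A) * lam)"

definition ark_nu :: "real mat \<Rightarrow> real \<Rightarrow> real" where
  "ark_nu A lam = ((fro_norm A)\<^sup>2 + real (dim_row A) * lam) / (min_row_sq A + lam)"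

definition ark_option :: "real mat \<Rightarrow> real \<Rightarrow> bool" where
  "ark_option A lam \<longleftrightarrow>
     lam = (fro_norm A)\<^sup>2 / real (dim_row A) \<or>
     lam = 0 \<and> 4 * min_row_sq A \<ge> max_row_sq A"

definition ark_data_repr ::
  "fp_arith \<Rightarrow> real mat \<Rightarrow> real vec \<Rightarrow> real \<Rightarrow> real \<Rightarrow> real \<Rightarrow> bool" where
  "ark_data_repr M A b lam \<mu> \<nu> \<longleftrightarrow>
     (\<forall>i<dim_row A. \<forall>j<dim_col A. A $$ (i, j) \<in> fp_repr M) \<and>
     (\<forall>i<dim_vec b. b $ i \<in> fp_repr M) \<and>
     {ark_alpha \<mu> \<nu>, 1 - ark_alpha \<mu> \<nu>, ark_beta \<mu> \<nu>, 1 - ark_beta \<mu> \<nu>,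
      ark_gamma \<mu> \<nu>, lam} \<subseteq> fp_repr M"

definition ark_error ::
  "fp_arith \<Rightarrow> real mat \<Rightarrow> real vec \<Rightarrow> real \<Rightarrow> nat \<Rightarrow> real" where
  "ark_error M A b lam k =
     measure_pmf.expectation (fp_ark_output M A b lam (ark_mu A lam) (ark_nu A lam) k)
       (\<lambda>z. l2_norm (z - mat_inv A *\<^sub>v b))"

end

theory Submission
  imports Defs "HOL-Analysis.L2_Norm"
begin

unbundle no vec_syntax and no inner_syntax

text \<open>In exact arithmetic the method contracts a potential in the mean.  Let \<open>S\<close> be the sum of the
  \<open>d i\<close>, where \<open>d i\<close> is the squared norm of row \<open>i\<close> plus \<open>lam\<close>; a row is drawn with probability
  \<open>d i / S\<close>, and the rank-one updates have mean \<open>H = A\<^sup>T A / S\<close>.  With \<open>x\<close> the solution, the potential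
  is \<open>P = \<sigma>\<^sup>2 |A\<^sup>-\<^sup>T (v - x)|\<^sup>2 + |y - x|\<^sup>2\<close>, a multiple of the usual one that measures the momentum
  vector \<open>v\<close> in the norm of the inverse of \<open>H\<close>.  One step multiplies its mean by at most \<open>1 - \<theta>\<close>,
  \<open>\<theta> = sqrt (\<mu> / \<nu>)\<close> (\<open>mean_potential_step\<close>): the decrease of the squared error of
  \<open>y\<close> pays for the update of \<open>v\<close>.  Either choice of \<open>lam\<close> balances the rows well enough for
  \<open>\<theta> \<ge> \<rho> = 1 / (2 \<kappa> sqrt n)\<close> (\<open>theta_ge\<close>).

  Rounding moves the result of a step by at most a multiple of \<open>n u \<kappa> R\<close> with
  \<open>R = |x| + sqrt P\<close> (\<open>fp_step_v_error\<close>, \<open>fp_step_y_error\<close>).  The factor \<open>\<kappa>\<close> comes from the size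
  of \<open>\<gamma>\<close> and of the momentum vector, which \<open>P\<close> controls only up to \<open>\<kappa>\<close>.  This crude bound suffices:
  errors of order \<open>\<kappa> u\<close> per step against a contraction gap of order \<open>1 / \<kappa>\<close> accumulate to order
  \<open>\<kappa>\<^sup>2 u\<close> up to powers of \<open>n\<close>, the asserted floor, and the part of the error that is proportional
  to \<open>sqrt P\<close> is absorbed by the gap exactly because \<open>\<kappa>\<^sup>2 u\<close> is small (\<open>mean_computed_step\<close>, \<open>expected_potential_le\<close>).
  The output depends on the momentum vector only with the small weight \<open>\<alpha>\<close>, so its error is, up to
  its own rounding, at most a constant times \<open>sqrt P\<close>; Jensen's inequality passes to the mean error (\<open>ark_error_le\<close>).

  The condition number and \<open>\<sigma>\<close> are given by a supremum and by eigenvalues.  The argument needs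
  that \<open>\<sigma>\<close> is the attained minimum of \<open>|A z| / |z|\<close> (\<open>sigma_min_properties\<close>).  This is obtained
  without a spectral theorem or compactness: if the infimum \<open>m\<close> of the squared quotient were no
  eigenvalue of \<open>A\<^sup>T A\<close>, then \<open>A\<^sup>T A - m\<close> would be positive semidefinite and invertible, hence its
  quadratic form would stay above a positive multiple of \<open>|z|\<^sup>2\<close>.\<close>

section \<open>Euclidean and Frobenius norms\<close>

lemma l2_norm_conv_L2_set: "l2_norm v = L2_set (\<lambda>i. v $ i) {..<dim_vec v}"
  by (simp add: l2_norm_def L2_set_def scalar_prod_def power2_eq_square lessThan_atLeast0)

lemma l2_norm_nonneg [simp]: "0 \<le> l2_norm v"
  by (simp add: l2_norm_conv_L2_set)

lemma l2_norm_sq: "(l2_norm v)\<^sup>2 = v \<bullet> v"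
proof -
  have "0 \<le> v \<bullet> v"
    by (auto simp: scalar_prod_def intro!: sum_nonneg)
  then show ?thesis
    by (simp add: l2_norm_def)
qed

lemma l2_norm_zero [simp]: "l2_norm (0\<^sub>v n) = 0"
  by (simp add: l2_norm_def)

lemma l2_norm_eq_0_iff:
  assumes "v \<in> carrier_vec n"
  shows "l2_norm v = 0 \<longleftrightarrow> v = 0\<^sub>v n"
  using assms by (auto simp: l2_norm_conv_L2_set L2_set_eq_0_iff)

lemma l2_norm_smult [simp]: "l2_norm (c \<cdot>\<^sub>v v) = \<bar>c\<bar> * l2_norm v"
  by (simp add: l2_norm_def real_sqrt_mult power2_eq_square[symmetric] mult.assoc[symmetric])

lemma l2_norm_triangle:
  assumes "v \<in> carrier_vec n" "w \<in> carrier_vec n"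
  shows "l2_norm (v + w) \<le> l2_norm v + l2_norm w"
proof -
  have "l2_norm (v + w) = L2_set (\<lambda>i. v $ i + w $ i) {..<n}"
    using assms by (auto simp: l2_norm_conv_L2_set intro!: L2_set_cong)
  then show ?thesis
    using assms L2_set_triangle_ineq[of "\<lambda>i. v $ i" "\<lambda>i. w $ i" "{..<n}"]
    by (auto simp: l2_norm_conv_L2_set)
qed

lemma l2_norm_uminus [simp]: "l2_norm (- v) = l2_norm v"
  by (simp add: l2_norm_def)

lemma l2_norm_diff_self [simp]: "l2_norm (v - v) = 0"
proof -
  have "v - v = 0\<^sub>v (dim_vec v)"
    by (intro eq_vecI) auto
  then show ?thesis
    by (simp only: l2_norm_zero)
qed

lemma l2_norm_diff_le:
  assumes "v \<in> carrier_vec n" "w \<in> carrier_vec n"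
  shows "l2_norm (v - w) \<le> l2_norm v + l2_norm w"
proof -
  have "v - w = v + (- w)"
    using assms by auto
  then show ?thesis
    using l2_norm_triangle[of v n "- w"] assms by simp
qed

lemma l2_norm_le_componentwise:
  assumes "v \<in> carrier_vec n" "w \<in> carrier_vec n" "0 \<le> c"
    and "\<And>i. i < n \<Longrightarrow> \<bar>v $ i\<bar> \<le> c * \<bar>w $ i\<bar>"
  shows "l2_norm v \<le> c * l2_norm w"
proof -
  have "l2_norm v = L2_set (\<lambda>i. \<bar>v $ i\<bar>) {..<n}"
    using assms(1) by (simp add: l2_norm_conv_L2_set L2_set_def)
  also have "\<dots> \<le> L2_set (\<lambda>i. c * \<bar>w $ i\<bar>) {..<n}"
    using assms by (intro L2_set_mono) auto
  also have "\<dots> = c * l2_norm w"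
    using assms(2,3) by (simp add: L2_set_right_distrib[symmetric] l2_norm_conv_L2_set)
      (simp add: L2_set_def)
  finally show ?thesis .
qed

lemma sum_abs_prod_le_l2_norm:
  assumes "v \<in> carrier_vec n" "w \<in> carrier_vec n"
  shows "(\<Sum>i<n. \<bar>v $ i * w $ i\<bar>) \<le> l2_norm v * l2_norm w"
  using assms L2_set_mult_ineq[of "\<lambda>i. v $ i" "\<lambda>i. w $ i" "{..<n}"]
  by (simp add: l2_norm_conv_L2_set abs_mult)

lemma abs_scalar_prod_le:
  assumes "v \<in> carrier_vec n" "w \<in> carrier_vec n"
  shows "\<bar>v \<bullet> w\<bar> \<le> l2_norm v * l2_norm w"
proof -
  have "\<bar>v \<bullet> w\<bar> \<le> (\<Sum>i<n. \<bar>v $ i * w $ i\<bar>)"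
    using assms by (simp add: scalar_prod_def lessThan_atLeast0 sum_abs)
  with sum_abs_prod_le_l2_norm[OF assms] show ?thesis by linarith
qed

lemma fro_norm_nonneg [simp]: "0 \<le> fro_norm A"
  by (simp add: fro_norm_def sum_nonneg)

lemma l2_norm_mult_mat_vec_sq:
  "(l2_norm (A *\<^sub>v z))\<^sup>2 = (\<Sum>i<dim_row A. (row A i \<bullet> z)\<^sup>2)"
proof -
  have "(A *\<^sub>v z) \<bullet> (A *\<^sub>v z) = (\<Sum>i<dim_row A. (row A i \<bullet> z)\<^sup>2)"
    by (simp add: scalar_prod_def[of "A *\<^sub>v z"] power2_eq_square lessThan_atLeast0)
  then show ?thesis
    by (simp add: l2_norm_sq)
qed

lemma l2_norm_mult_mat_vec_le_fro:
  assumes A: "A \<in> carrier_mat nr nc" and z: "z \<in> carrier_vec nc"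
  shows "l2_norm (A *\<^sub>v z) \<le> fro_norm A * l2_norm z"
proof -
  have "(row A i \<bullet> z)\<^sup>2 \<le> row_sq A i * (l2_norm z)\<^sup>2" for i
  proof -
    have "\<bar>row A i \<bullet> z\<bar> \<le> l2_norm (row A i) * l2_norm z"
      using A z by (intro abs_scalar_prod_le[of _ nc]) auto
    then have "\<bar>row A i \<bullet> z\<bar>\<^sup>2 \<le> (l2_norm (row A i) * l2_norm z)\<^sup>2"
      by (intro power_mono) auto
    then show ?thesis
      by (simp add: row_sq_def power_mult_distrib)
  qed
  then have "(l2_norm (A *\<^sub>v z))\<^sup>2 \<le> (\<Sum>i<dim_row A. row_sq A i * (l2_norm z)\<^sup>2)"
    unfolding l2_norm_mult_mat_vec_sq by (intro sum_mono)
  also have "\<dots> = (fro_norm A * l2_norm z)\<^sup>2"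
    by (simp add: sum_distrib_right[symmetric] sum_row_sq power_mult_distrib)
  finally show ?thesis
    by (rule power2_le_imp_le) simp
qed

lemma mult_mat_vec_le_spectral_norm:
  assumes A: "A \<in> carrier_mat nr nc" and z: "z \<in> carrier_vec nc"
  shows "l2_norm (A *\<^sub>v z) \<le> spectral_norm A * l2_norm z"
proof (cases "l2_norm z = 0")
  case True
  then show ?thesis
    using l2_norm_mult_mat_vec_le_fro[OF A z] by simp
next
  case False
  let ?S = "{l2_norm (A *\<^sub>v z) | z. z \<in> carrier_vec (dim_col A) \<and> l2_norm z = 1}"
  let ?c = "1 / l2_norm z"
  have c: "?c > 0"
    using False by (simp add: less_le)
  have "bdd_above ?S"
    using l2_norm_mult_mat_vec_le_fro[of A nr nc] A
    by (intro bdd_aboveI[of _ "fro_norm A"]) fastforce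
  moreover have "l2_norm (A *\<^sub>v (?c \<cdot>\<^sub>v z)) \<in> ?S"
    using z A c False by auto
  ultimately have "l2_norm (A *\<^sub>v (?c \<cdot>\<^sub>v z)) \<le> spectral_norm A"
    unfolding spectral_norm_def by (rule cSup_upper[rotated])
  moreover have "A *\<^sub>v (?c \<cdot>\<^sub>v z) = ?c \<cdot>\<^sub>v (A *\<^sub>v z)"
    using A z by (simp add: mult_mat_vec)
  ultimately show ?thesis
    using c by (simp add: field_simps)
qed

lemma mat_inv_inverse:
  fixes A :: "real mat"
  assumes A: "A \<in> carrier_mat n n" and inv: "invertible_mat A"
  shows "mat_inv A \<in> carrier_mat n n" "A * mat_inv A = 1\<^sub>m n" "mat_inv A * A = 1\<^sub>m n"
proof -
  obtain B where B: "inverts_mat A B" "inverts_mat B A"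
    using inv unfolding invertible_mat_def by blast
  have AB: "A * B = 1\<^sub>m n"
    using B(1) A unfolding inverts_mat_def carrier_matD(1)[OF A] by blast
  have BA: "B * A = 1\<^sub>m (dim_row B)"
    using B(2) unfolding inverts_mat_def by blast
  have "dim_col B = n"
    using arg_cong[OF AB, of dim_col] by simp
  moreover have "dim_row B = n"
    using arg_cong[OF BA, of dim_col] A by simp
  ultimately have Bc: "B \<in> carrier_mat n n" and BA': "B * A = 1\<^sub>m n"
    using BA by auto
  then have "A \<in> Units (ring_mat TYPE(real) n ())"
    using A Bc AB BA' unfolding Units_def ring_mat_simps by blast
  then obtain C where "mat_inverse A = Some C"
    using mat_inverse(1)[OF A, of "()"] by (cases "mat_inverse A") auto
  with mat_inverse(2)[OF A this]
  show "mat_inv A \<in> carrier_mat n n" "A * mat_inv A = 1\<^sub>m n" "mat_inv A * A = 1\<^sub>m n"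
    by (simp_all add: mat_inv_def \<open>mat_inverse A = Some C\<close>)
qed

section \<open>The smallest singular value\<close>

lemma gram_scalar_prod:
  fixes A :: "real mat"
  assumes A: "A \<in> carrier_mat nr n" and x: "x \<in> carrier_vec n" and y: "y \<in> carrier_vec n"
  shows "x \<bullet> ((A\<^sup>T * A) *\<^sub>v y) = (A *\<^sub>v x) \<bullet> (A *\<^sub>v y)"
proof -
  have "(A\<^sup>T * A) *\<^sub>v y = A\<^sup>T *\<^sub>v (A *\<^sub>v y)"
    using A y by (intro assoc_mult_mat_vec) auto
  then show ?thesis
    using A x y transpose_vec_mult_scalar[of A nr n x "A *\<^sub>v y"]
      comm_scalar_prod[of x n "A\<^sup>T *\<^sub>v (A *\<^sub>v y)"] comm_scalar_prod[of "A *\<^sub>v y" nr "A *\<^sub>v x"]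
    by simp
qed

text \<open>Nonnegativity of the form at the point reached from \<open>z\<close> by a gradient step along \<open>w = N z\<close>
  gives the bound.  For invertible \<open>N\<close> it turns semidefiniteness into a quantitative lower bound.\<close>

lemma psd_form_ge_image:
  fixes N :: "real mat"
  assumes N: "N \<in> carrier_mat n n" and z: "z \<in> carrier_vec n"
    and sym: "\<And>x y. x \<in> carrier_vec n \<Longrightarrow> y \<in> carrier_vec n \<Longrightarrow> x \<bullet> (N *\<^sub>v y) = y \<bullet> (N *\<^sub>v x)"
    and psd: "\<And>x. x \<in> carrier_vec n \<Longrightarrow> 0 \<le> x \<bullet> (N *\<^sub>v x)"
  shows "(l2_norm (N *\<^sub>v z))\<^sup>2 \<le> (fro_norm N + 1) * (z \<bullet> (N *\<^sub>v z))"
proof -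
  define w where "w = N *\<^sub>v z"
  define f where "f = fro_norm N + 1"
  have w: "w \<in> carrier_vec n" and f: "f > 0"
    using N z by (auto simp: w_def f_def add_nonneg_pos)
  define t where "t = - 1 / f"
  have "0 \<le> (z + t \<cdot>\<^sub>v w) \<bullet> (N *\<^sub>v (z + t \<cdot>\<^sub>v w))"
    using z w by (intro psd) auto
  also have "N *\<^sub>v (z + t \<cdot>\<^sub>v w) = w + t \<cdot>\<^sub>v (N *\<^sub>v w)"
    using N z w by (simp add: mult_add_distrib_mat_vec mult_mat_vec w_def)
  also have "(z + t \<cdot>\<^sub>v w) \<bullet> (w + t \<cdot>\<^sub>v (N *\<^sub>v w)) = z \<bullet> w + 2 * t * (w \<bullet> w) + t\<^sup>2 * (w \<bullet> (N *\<^sub>v w))"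
  proof -
    have "z \<bullet> (N *\<^sub>v w) = w \<bullet> w"
      using sym[OF z w] by (simp add: w_def)
    then show ?thesis
      using N z w by (simp add: add_scalar_prod_distrib[of _ n] scalar_prod_add_distrib[of _ n]
          algebra_simps power2_eq_square)
  qed
  finally have *: "0 \<le> z \<bullet> w + 2 * t * (w \<bullet> w) + t\<^sup>2 * (w \<bullet> (N *\<^sub>v w))" .
  have "w \<bullet> (N *\<^sub>v w) \<le> l2_norm w * l2_norm (N *\<^sub>v w)"
    using abs_scalar_prod_le[of w n "N *\<^sub>v w"] w N by auto
  also have "\<dots> \<le> l2_norm w * (f * l2_norm w)"
  proof (intro mult_left_mono)
    show "l2_norm (N *\<^sub>v w) \<le> f * l2_norm w"
      using l2_norm_mult_mat_vec_le_fro[OF N w] by (simp add: f_def distrib_right add_increasing2)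
  qed auto
  also have "\<dots> = f * (w \<bullet> w)"
    by (simp add: l2_norm_sq[symmetric] power2_eq_square)
  finally have "t\<^sup>2 * (w \<bullet> (N *\<^sub>v w)) \<le> t\<^sup>2 * (f * (w \<bullet> w))"
    by (intro mult_left_mono) auto
  with * have "0 \<le> z \<bullet> w + 2 * t * (w \<bullet> w) + t\<^sup>2 * (f * (w \<bullet> w))"
    by linarith
  also have "\<dots> = z \<bullet> w - (w \<bullet> w) / f"
    using f by (simp add: t_def power2_eq_square field_simps)
  finally have "w \<bullet> w \<le> f * (z \<bullet> w)"
    using f by (simp add: field_simps)
  then show ?thesis
    by (simp add: l2_norm_sq w_def f_def)
qed

text \<open>The witness is the infimum \<open>m\<close> of the Rayleigh quotient.  If \<open>A\<^sup>T A - m\<close> were invertible,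
  \<open>psd_form_ge_image\<close> would push all quotients above \<open>m\<close> by a fixed amount.\<close>

lemma gram_least_eigenvalue:
  fixes A :: "real mat"
  assumes A: "A \<in> carrier_mat nr n" and n: "0 < n"
  shows "\<exists>m\<ge>0. eigenvalue (A\<^sup>T * A) m \<and>
           (\<forall>z\<in>carrier_vec n. m * (l2_norm z)\<^sup>2 \<le> (l2_norm (A *\<^sub>v z))\<^sup>2)"
proof -
  define Q where "Q = {(l2_norm (A *\<^sub>v z))\<^sup>2 | z. z \<in> carrier_vec n \<and> l2_norm z = 1}"
  define m where "m = Inf Q"
  have "l2_norm (unit_vec n 0) = 1"
    using n by (simp add: l2_norm_def)
  then have Qne: "Q \<noteq> {}"
    unfolding Q_def using unit_vec_carrier by blast
  have m0: "m \<ge> 0"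
    unfolding m_def using Qne by (intro cInf_greatest) (auto simp: Q_def)
  have bdd: "bdd_below Q"
    by (rule bdd_belowI[of _ 0]) (auto simp: Q_def)
  have rayleigh: "m * (l2_norm z)\<^sup>2 \<le> (l2_norm (A *\<^sub>v z))\<^sup>2" if z: "z \<in> carrier_vec n" for z
  proof (cases "l2_norm z = 0")
    case False
    let ?c = "1 / l2_norm z"
    have "(l2_norm (A *\<^sub>v (?c \<cdot>\<^sub>v z)))\<^sup>2 \<in> Q"
      unfolding Q_def using z False by auto
    then have "m \<le> (l2_norm (A *\<^sub>v (?c \<cdot>\<^sub>v z)))\<^sup>2"
      unfolding m_def using bdd by (rule cInf_lower)
    then show ?thesis
      using A z False by (simp add: mult_mat_vec power_mult_distrib field_simps)
  qed auto
  let ?M = "A\<^sup>T * A"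
  let ?N = "char_matrix ?M m"
  have M: "?M \<in> carrier_mat n n"
    using A by auto
  have N: "?N \<in> carrier_mat n n"
    using M by (auto simp: char_matrix_def)
  have Nv: "?N *\<^sub>v y = ?M *\<^sub>v y + (- m) \<cdot>\<^sub>v y" if "y \<in> carrier_vec n" for y
  proof -
    have "?N *\<^sub>v y = ?M *\<^sub>v y + ((- m) \<cdot>\<^sub>m 1\<^sub>m n) *\<^sub>v y"
      unfolding char_matrix_def using M that A
      by (subst add_mult_distrib_mat_vec[of _ n n]) auto
    also have "((- m) \<cdot>\<^sub>m 1\<^sub>m n) *\<^sub>v y = (- m) \<cdot>\<^sub>v y"
      using that by (intro eq_vecI) auto
    finally show ?thesis .
  qed
  have Nform: "x \<bullet> (?N *\<^sub>v y) = (A *\<^sub>v x) \<bullet> (A *\<^sub>v y) - m * (x \<bullet> y)"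
    if "x \<in> carrier_vec n" "y \<in> carrier_vec n" for x y
    using that M Nv[of y] gram_scalar_prod[OF A that]
    by (simp add: scalar_prod_add_distrib[of _ n])
  have "det ?N = 0"
  proof (rule ccontr)
    assume "det ?N \<noteq> 0"
    then have "?N \<in> Units (ring_mat TYPE(real) n ())"
      by (rule det_non_zero_imp_unit[OF N])
    then obtain C where C: "C \<in> carrier_mat n n" "C * ?N = 1\<^sub>m n"
      unfolding Units_def by (auto simp: ring_mat_simps)
    define f where "f = fro_norm ?N + 1"
    define g where "g = (fro_norm C)\<^sup>2 + 1"
    have pos: "f > 0" "g > 0"
      by (auto simp: f_def g_def add_nonneg_pos)
    have "m + 1 / (f * g) \<le> q" if qQ: "q \<in> Q" for q
    proof -
      obtain z where z: "z \<in> carrier_vec n" "l2_norm z = 1" and q: "q = (l2_norm (A *\<^sub>v z))\<^sup>2"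
        using qQ by (auto simp: Q_def)
      have form: "z \<bullet> (?N *\<^sub>v z) = q - m"
        using Nform[of z z] z by (simp add: q l2_norm_sq[symmetric])
      have "(l2_norm (?N *\<^sub>v z))\<^sup>2 \<le> f * (z \<bullet> (?N *\<^sub>v z))"
        unfolding f_def
      proof (rule psd_form_ge_image[OF N z(1)])
        fix x y :: "real vec" assume xy: "x \<in> carrier_vec n" "y \<in> carrier_vec n"
        show "x \<bullet> (?N *\<^sub>v y) = y \<bullet> (?N *\<^sub>v x)"
          using Nform[OF xy] Nform[OF xy(2,1)] comm_scalar_prod[OF xy]
            comm_scalar_prod[of "A *\<^sub>v x" nr "A *\<^sub>v y"] A xy by simp
      next
        fix x :: "real vec" assume "x \<in> carrier_vec n"
        then show "0 \<le> x \<bullet> (?N *\<^sub>v x)"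
          using Nform[of x x] rayleigh[of x] by (simp add: l2_norm_sq)
      qed
      moreover have "1 \<le> g * (l2_norm (?N *\<^sub>v z))\<^sup>2"
      proof -
        have "z = C *\<^sub>v (?N *\<^sub>v z)"
          using assoc_mult_mat_vec[OF C(1) N z(1)] C(2) z(1) by simp
        then have "1 \<le> fro_norm C * l2_norm (?N *\<^sub>v z)"
          using l2_norm_mult_mat_vec_le_fro[OF C(1), of "?N *\<^sub>v z"] N z by simp
        then have "1\<^sup>2 \<le> (fro_norm C * l2_norm (?N *\<^sub>v z))\<^sup>2"
          by (intro power_mono) auto
        also have "\<dots> \<le> g * (l2_norm (?N *\<^sub>v z))\<^sup>2"
          by (simp add: g_def power_mult_distrib mult_right_mono)
        finally show ?thesis by simp
      qed
      ultimately have "1 \<le> g * (f * (q - m))"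
        using pos(2) by (simp add: form) (meson mult_left_mono less_imp_le order_trans)
      then show ?thesis
        using pos by (simp add: field_simps)
    qed
    then have "m + 1 / (f * g) \<le> m"
      unfolding m_def[of] using Qne by (intro cInf_greatest) (auto simp: m_def)
    then show False
      using pos by (simp add: field_simps)
  qed
  then have "eigenvalue ?M m"
    by (simp add: eigenvalue_det[OF M])
  with m0 rayleigh show ?thesis by blast
qed

text \<open>Every singular value dominates the least eigenvalue of \<open>A\<^sup>T A\<close> through the Rayleigh quotient of
  its eigenvector, so the minimum in \<open>sigma_min\<close> is the square root of that eigenvalue; there are
  finitely many singular values because eigenvalues are roots of the characteristic polynomial.\<close>

lemma sigma_min_properties:
  fixes A :: "real mat"
  assumes A: "A \<in> carrier_mat nr n" and n: "0 < n"
  shows sigma_min_nonneg: "0 \<le> sigma_min A"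
    and sigma_min_le: "\<And>z. z \<in> carrier_vec n \<Longrightarrow> sigma_min A * l2_norm z \<le> l2_norm (A *\<^sub>v z)"
    and sigma_min_attained:
      "\<exists>z\<in>carrier_vec n. z \<noteq> 0\<^sub>v n \<and> l2_norm (A *\<^sub>v z) = sigma_min A * l2_norm z"
proof -
  let ?M = "A\<^sup>T * A"
  have M: "?M \<in> carrier_mat n n"
    using A by auto
  obtain m where m: "m \<ge> 0" "eigenvalue ?M m"
    and rayleigh: "\<And>z. z \<in> carrier_vec n \<Longrightarrow> m * (l2_norm z)\<^sup>2 \<le> (l2_norm (A *\<^sub>v z))\<^sup>2"
    using gram_least_eigenvalue[OF A n] by blast
  have eig: "\<exists>z\<in>carrier_vec n. z \<noteq> 0\<^sub>v n \<and> l2_norm (A *\<^sub>v z) = s * l2_norm z"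
    if s: "s \<ge> 0" "eigenvalue ?M (s\<^sup>2)" for s
  proof -
    obtain z where z: "z \<in> carrier_vec n" "z \<noteq> 0\<^sub>v n" "?M *\<^sub>v z = s\<^sup>2 \<cdot>\<^sub>v z"
      using s(2) A unfolding eigenvalue_def eigenvector_def by auto
    have "(l2_norm (A *\<^sub>v z))\<^sup>2 = (s * l2_norm z)\<^sup>2"
      using gram_scalar_prod[OF A z(1) z(1)] z by (simp add: l2_norm_sq power_mult_distrib)
    then have "l2_norm (A *\<^sub>v z) = s * l2_norm z"
      using s(1) by (simp add: power2_eq_iff_nonneg)
    with z show ?thesis by blast
  qed
  have "finite {k. poly (char_poly ?M) k = 0}"
  proof (rule poly_roots_finite)
    show "char_poly ?M \<noteq> 0"
      using degree_monic_char_poly[OF M] by fastforce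
  qed
  then have "finite (sqrt ` {k. eigenvalue ?M k})"
    by (simp add: eigenvalue_root_char_poly[OF M])
  moreover have "singular_values A \<subseteq> sqrt ` {k. eigenvalue ?M k}"
  proof
    fix s assume "s \<in> singular_values A"
    then have "s = sqrt (s\<^sup>2)" "eigenvalue ?M (s\<^sup>2)"
      by (auto simp: singular_values_def)
    then show "s \<in> sqrt ` {k. eigenvalue ?M k}"
      by blast
  qed
  ultimately have fin: "finite (singular_values A)"
    by (rule finite_subset[rotated])
  have mem: "sqrt m \<in> singular_values A"
    using m by (simp add: singular_values_def)
  have "sqrt m \<le> s" if "s \<in> singular_values A" for s
  proof -
    have s: "s \<ge> 0" "eigenvalue ?M (s\<^sup>2)"
      using that by (auto simp: singular_values_def)
    obtain z where z: "z \<in> carrier_vec n" "z \<noteq> 0\<^sub>v n" "l2_norm (A *\<^sub>v z) = s * l2_norm z"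
      using eig[OF s] by blast
    have "m * (l2_norm z)\<^sup>2 \<le> s\<^sup>2 * (l2_norm z)\<^sup>2"
      using rayleigh[OF z(1)] z(3) by (simp add: power_mult_distrib)
    moreover have "(l2_norm z)\<^sup>2 > 0"
      using z l2_norm_eq_0_iff[OF z(1)] by simp
    ultimately have "m \<le> s\<^sup>2"
      by simp
    then show ?thesis
      using s(1) by (simp add: real_le_lsqrt)
  qed
  then have eq: "sigma_min A = sqrt m"
    unfolding sigma_min_def using fin mem by (intro Min_eqI)
  show "0 \<le> sigma_min A"
    using m by (simp add: eq)
  show "sigma_min A * l2_norm z \<le> l2_norm (A *\<^sub>v z)" if "z \<in> carrier_vec n" for z
    by (rule power2_le_imp_le) (use rayleigh[OF that] m in \<open>auto simp: eq power_mult_distrib\<close>)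
  show "\<exists>z\<in>carrier_vec n. z \<noteq> 0\<^sub>v n \<and> l2_norm (A *\<^sub>v z) = sigma_min A * l2_norm z"
    using eig[of "sqrt m"] m by (simp add: eq)
qed

section \<open>One exact step in the mean\<close>

lemma l2_norm_add_smult_sq:
  assumes "x \<in> carrier_vec n" "y \<in> carrier_vec n"
  shows "(l2_norm (x + c \<cdot>\<^sub>v y))\<^sup>2 = (l2_norm x)\<^sup>2 + 2 * c * (x \<bullet> y) + c\<^sup>2 * (l2_norm y)\<^sup>2"
proof -
  have "(x + c \<cdot>\<^sub>v y) \<bullet> (x + c \<cdot>\<^sub>v y) = x \<bullet> x + 2 * c * (x \<bullet> y) + c\<^sup>2 * (y \<bullet> y)"
    using assms comm_scalar_prod[OF assms]
    by (simp add: add_scalar_prod_distrib[of _ n] scalar_prod_add_distrib[of _ n]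
        power2_eq_square algebra_simps)
  then show ?thesis
    by (simp add: l2_norm_sq)
qed

lemma two_scalar_prod_le:
  assumes "x \<in> carrier_vec n" "y \<in> carrier_vec n"
  shows "2 * (x \<bullet> y) \<le> (l2_norm x)\<^sup>2 + (l2_norm y)\<^sup>2"
proof -
  have "0 \<le> (l2_norm (x + (- 1) \<cdot>\<^sub>v y))\<^sup>2"
    by simp
  then show ?thesis
    unfolding l2_norm_add_smult_sq[OF assms] by simp
qed

lemma l2_norm_sq_convex:
  assumes "x \<in> carrier_vec n" "y \<in> carrier_vec n" "0 \<le> t" "t \<le> 1"
  shows "(l2_norm ((1 - t) \<cdot>\<^sub>v x + t \<cdot>\<^sub>v y))\<^sup>2 \<le> (1 - t) * (l2_norm x)\<^sup>2 + t * (l2_norm y)\<^sup>2"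
proof -
  have "(1 - t) * t * (2 * (x \<bullet> y)) \<le> (1 - t) * t * ((l2_norm x)\<^sup>2 + (l2_norm y)\<^sup>2)"
    using assms by (intro mult_left_mono two_scalar_prod_le[of _ n]) auto
  moreover have "(l2_norm ((1 - t) \<cdot>\<^sub>v x + t \<cdot>\<^sub>v y))\<^sup>2 =
      (1 - t)\<^sup>2 * (l2_norm x)\<^sup>2 + (1 - t) * t * (2 * (x \<bullet> y)) + t\<^sup>2 * (l2_norm y)\<^sup>2"
    using assms by (subst l2_norm_add_smult_sq[of _ n]) (auto simp: power_mult_distrib)
  ultimately show ?thesis
    by (simp add: power2_eq_square algebra_simps)
qed

text \<open>The weighted form of the triangle inequality for squares; it separates the exact step from its
  rounding error at the price of a factor \<open>1 + e\<close> close to 1.\<close>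

lemma l2_norm_sq_add_le:
  assumes "x \<in> carrier_vec n" "y \<in> carrier_vec n" "0 < e"
  shows "(l2_norm (x + y))\<^sup>2 \<le> (1 + e) * (l2_norm x)\<^sup>2 + (1 + 1 / e) * (l2_norm y)\<^sup>2"
proof -
  have "(l2_norm (x + (- 1 / e) \<cdot>\<^sub>v y))\<^sup>2 \<ge> 0"
    by simp
  then have "2 * (x \<bullet> y) \<le> e * (l2_norm x)\<^sup>2 + (l2_norm y)\<^sup>2 / e"
    using assms(3) unfolding l2_norm_add_smult_sq[OF assms(1,2)]
    by (simp add: field_simps power2_eq_square)
  moreover have "(l2_norm (x + y))\<^sup>2 = (l2_norm x)\<^sup>2 + 2 * (x \<bullet> y) + (l2_norm y)\<^sup>2"
    using l2_norm_add_smult_sq[OF assms(1,2), of 1] by simp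
  ultimately show ?thesis
    by (simp add: algebra_simps)
qed

locale kaczmarz =
  fixes A :: "real mat" and n :: nat and lam :: real
  assumes A [simp]: "A \<in> carrier_mat n n" and n_pos: "0 < n"
    and invertible: "invertible_mat A" and lam_nonneg: "0 \<le> lam"
begin

abbreviation "\<sigma> \<equiv> sigma_min A"
abbreviation "F \<equiv> fro_norm A"
abbreviation "\<kappa> \<equiv> demmel_cond A"
abbreviation "\<mu> \<equiv> ark_mu A lam"
abbreviation "\<nu> \<equiv> ark_nu A lam"

definition S :: real where "S = F\<^sup>2 + real n * lam"
definition d :: "nat \<Rightarrow> real" where "d i = row_sq A i + lam"
definition dmin :: real where "dmin = min_row_sq A + lam"

text \<open>With \<open>H = A\<^sup>T A / S\<close>, the mean of the rank-one updates, the natural norm for the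
  momentum sequence is the one of \<open>H\<close> inverse; up to a constant factor it is the norm of \<open>lift z\<close>.
  In these coordinates the update direction \<open>a\<^sub>i\<close> becomes the unit vector \<open>e\<^sub>i\<close>.\<close>

definition lift :: "real vec \<Rightarrow> real vec" where "lift z = (mat_inv A)\<^sup>T *\<^sub>v z"

definition \<theta> :: real where "\<theta> = \<sigma> * sqrt dmin / S"

lemma dims [simp]: "dim_row A = n" "dim_col A = n"
  using carrier_matD[OF A] by auto

lemma row_carrier [simp]: "row A i \<in> carrier_vec n"
  by (rule carrier_vecI) simp

lemma mult_carrier [simp]: "z \<in> carrier_vec n \<Longrightarrow> A *\<^sub>v z \<in> carrier_vec n"
  by (rule mult_mat_vec_carrier[OF A])

lemmas inv_carrier [simp] = mat_inv_inverse(1)[OF A invertible]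

lemma inv_mult_carrier [simp]: "z \<in> carrier_vec n \<Longrightarrow> mat_inv A *\<^sub>v z \<in> carrier_vec n"
  by (rule mult_mat_vec_carrier[OF inv_carrier])

lemma inv_transpose_carrier: "(mat_inv A)\<^sup>T \<in> carrier_mat n n"
  by simp

lemma lift_carrier [simp]: "z \<in> carrier_vec n \<Longrightarrow> lift z \<in> carrier_vec n"
  unfolding lift_def by (rule mult_mat_vec_carrier[OF inv_transpose_carrier])

lemma inv_mult_vec: "z \<in> carrier_vec n \<Longrightarrow> mat_inv A *\<^sub>v (A *\<^sub>v z) = z"
  using assoc_mult_mat_vec[OF inv_carrier A, of z] mat_inv_inverse(3)[OF A invertible] by simp

lemma mult_inv_vec: "z \<in> carrier_vec n \<Longrightarrow> A *\<^sub>v (mat_inv A *\<^sub>v z) = z"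
  using assoc_mult_mat_vec[OF A inv_carrier, of z] mat_inv_inverse(2)[OF A invertible] by simp

lemma lift_add: "x \<in> carrier_vec n \<Longrightarrow> y \<in> carrier_vec n \<Longrightarrow> lift (x + y) = lift x + lift y"
  unfolding lift_def by (rule mult_add_distrib_mat_vec[OF inv_transpose_carrier])

lemma lift_smult: "x \<in> carrier_vec n \<Longrightarrow> lift (c \<cdot>\<^sub>v x) = c \<cdot>\<^sub>v lift x"
  unfolding lift_def by (rule mult_mat_vec[OF inv_transpose_carrier])

lemma lift_row: "i < n \<Longrightarrow> lift (row A i) = unit_vec n i"
proof -
  assume i: "i < n"
  have "(A * mat_inv A) $$ (i, j) = unit_vec n i $ j" if "j < n" for j
    using i that mat_inv_inverse(2)[OF A invertible] by simp
  then have "row A i \<bullet> col (mat_inv A) j = unit_vec n i $ j" if "j < n" for j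
    using i that carrier_matD[OF inv_carrier] by simp
  moreover have "col (mat_inv A) j \<bullet> row A i = row A i \<bullet> col (mat_inv A) j" for j
    by (rule comm_scalar_prod[of _ n]) (simp_all add: carrier_matD[OF inv_carrier] carrier_vecI)
  ultimately show "lift (row A i) = unit_vec n i"
    unfolding lift_def using carrier_matD[OF inv_carrier] by (intro eq_vecI) auto
qed

lemma lift_scalar_prod:
  assumes "z \<in> carrier_vec n" "x \<in> carrier_vec n"
  shows "lift z \<bullet> (A *\<^sub>v x) = z \<bullet> x"
  using assms transpose_vec_mult_scalar[OF inv_carrier, of "A *\<^sub>v x" z]
  by (simp add: lift_def inv_mult_vec)

text \<open>In both directions the comparison of \<open>z\<close> with \<open>lift z\<close> comes from the adjointness
  \<open>lift_scalar_prod\<close> and the Cauchy-Schwarz inequality.\<close>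

lemma l2_norm_le_fro_lift:
  assumes z: "z \<in> carrier_vec n"
  shows "l2_norm z \<le> F * l2_norm (lift z)"
proof (cases "l2_norm z = 0")
  case False
  have "(l2_norm z)\<^sup>2 = lift z \<bullet> (A *\<^sub>v z)"
    using lift_scalar_prod[OF z z] by (simp add: l2_norm_sq)
  also have "\<dots> \<le> l2_norm (lift z) * l2_norm (A *\<^sub>v z)"
    using abs_scalar_prod_le[of "lift z" n "A *\<^sub>v z"] z by auto
  also have "\<dots> \<le> l2_norm (lift z) * (F * l2_norm z)"
    using l2_norm_mult_mat_vec_le_fro[OF A z] by (intro mult_left_mono) auto
  finally have "l2_norm z * l2_norm z \<le> (F * l2_norm (lift z)) * l2_norm z"
    by (simp add: power2_eq_square mult_ac)
  moreover have "l2_norm z > 0"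
    using False by (simp add: less_le)
  ultimately show ?thesis by simp
qed simp

lemma sigma_lift_le:
  assumes z: "z \<in> carrier_vec n"
  shows "\<sigma> * l2_norm (lift z) \<le> l2_norm z"
proof (cases "l2_norm (lift z) = 0")
  case False
  define y where "y = mat_inv A *\<^sub>v lift z"
  have y: "y \<in> carrier_vec n" "A *\<^sub>v y = lift z"
    using z by (auto simp: y_def mult_inv_vec)
  have "l2_norm (lift z) * l2_norm (lift z) = z \<bullet> y"
    using lift_scalar_prod[OF z y(1)] by (simp add: y(2) l2_norm_sq[symmetric] power2_eq_square)
  also have "\<dots> \<le> l2_norm z * l2_norm y"
    using abs_scalar_prod_le[of z n y] z y by auto
  finally have "\<sigma> * (l2_norm (lift z) * l2_norm (lift z)) \<le> \<sigma> * (l2_norm z * l2_norm y)"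
    using sigma_min_nonneg[OF A n_pos] by (intro mult_left_mono)
  also have "\<dots> \<le> l2_norm z * l2_norm (lift z)"
    using mult_left_mono[OF sigma_min_le[OF A n_pos y(1)], of "l2_norm z"] y(2)
    by (simp add: mult_ac)
  finally have "(\<sigma> * l2_norm (lift z)) * l2_norm (lift z) \<le> l2_norm z * l2_norm (lift z)"
    by (simp add: mult_ac)
  moreover have "l2_norm (lift z) > 0"
    using False by (simp add: less_le)
  ultimately show ?thesis by simp
qed simp

text \<open>A vector at which \<open>A\<close> shrinks by the factor \<open>\<sigma>\<close> is stretched back by the inverse, whose spectral
  norm is therefore at least \<open>1 / \<sigma>\<close>.\<close>

lemma sigma_pos: "0 < \<sigma>"
  and fro_over_sigma_le_cond: "F / \<sigma> \<le> \<kappa>"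
proof -
  obtain z where z: "z \<in> carrier_vec n" "z \<noteq> 0\<^sub>v n" "l2_norm (A *\<^sub>v z) = \<sigma> * l2_norm z"
    using sigma_min_attained[OF A n_pos] by blast
  have pos: "l2_norm z > 0"
    using z l2_norm_eq_0_iff[OF z(1)] by (simp add: less_le)
  have "l2_norm z \<le> spectral_norm (mat_inv A) * l2_norm (A *\<^sub>v z)"
    using mult_mat_vec_le_spectral_norm[OF inv_carrier, of "A *\<^sub>v z"] z by (simp add: inv_mult_vec)
  then have le: "1 \<le> spectral_norm (mat_inv A) * \<sigma>"
    using pos z(3) by simp
  then have "\<sigma> \<noteq> 0" by auto
  then show "0 < \<sigma>"
    using sigma_min_nonneg[OF A n_pos] by simp
  with le have "1 / \<sigma> \<le> spectral_norm (mat_inv A)"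
    by (simp add: field_simps)
  then show "F / \<sigma> \<le> \<kappa>"
    unfolding demmel_cond_def using mult_left_mono[of "1 / \<sigma>" _ F] by simp
qed

lemma sigma_le_fro: "\<sigma> \<le> F"
proof -
  have "l2_norm (unit_vec n 0) = 1"
    using n_pos by (simp add: l2_norm_def)
  then show ?thesis
    using sigma_min_le[OF A n_pos, of "unit_vec n 0"]
      l2_norm_mult_mat_vec_le_fro[OF A, of "unit_vec n 0"] by simp
qed

lemma fro_pos: "0 < F"
  using sigma_pos sigma_le_fro by linarith

lemma cond_ge_1: "1 \<le> \<kappa>"
  proof -
  have "1 \<le> F / \<sigma>"
    using sigma_le_fro sigma_pos by simp
  with fro_over_sigma_le_cond show ?thesis by linarith
qed

lemma sum_d: "(\<Sum>i<n. d i) = S"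
  using sum_row_sq[of A] by (simp add: d_def S_def sum.distrib)

text \<open>Row \<open>i\<close> is lifted to a unit vector, so its norm is at least \<open>\<sigma>\<close>.\<close>

lemma row_sq_pos: "i < n \<Longrightarrow> 0 < row_sq A i"
proof -
  assume i: "i < n"
  have "\<sigma> * l2_norm (unit_vec n i) \<le> l2_norm (row A i)"
    using sigma_lift_le[of "row A i"] lift_row[OF i] by simp
  moreover have "l2_norm (unit_vec n i) = 1"
    using i by (simp add: l2_norm_def)
  ultimately have "0 < l2_norm (row A i)"
    using sigma_pos by simp
  then show "0 < row_sq A i"
    by (simp add: row_sq_def)
qed

lemma dmin_le: "i < n \<Longrightarrow> dmin \<le> d i"
  by (auto simp: dmin_def d_def min_row_sq_def intro!: Min_le)

lemma min_row_sq_pos: "0 < min_row_sq A"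
proof -
  have "row_sq A ` {..<n} \<noteq> {}"
    using n_pos by auto
  then show ?thesis
    using row_sq_pos by (auto simp: min_row_sq_def)
qed

lemma dmin_pos: "0 < dmin"
  using min_row_sq_pos lam_nonneg by (simp add: dmin_def)

lemma d_pos: "i < n \<Longrightarrow> 0 < d i"
  using dmin_le dmin_pos by force

lemma S_pos: "0 < S"
  using fro_pos lam_nonneg by (simp add: S_def add_pos_nonneg)

lemma fro_sq_le_S: "F\<^sup>2 \<le> S"
  using lam_nonneg by (simp add: S_def)

lemma dmin_le_S: "dmin \<le> S"
proof -
  have "dmin \<le> d 0"
    using dmin_le n_pos by simp
  also have "\<dots> \<le> (\<Sum>i<n. d i)"
    using n_pos d_pos by (intro member_le_sum) (auto simp: less_imp_le)
  finally show ?thesis by (simp add: sum_d)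
qed

lemma mu_eq: "\<mu> = \<sigma>\<^sup>2 / S" and nu_eq: "\<nu> = S / dmin"
  by (simp_all add: ark_mu_def ark_nu_def S_def dmin_def)

lemma theta_pos: "0 < \<theta>"
  using sigma_pos dmin_pos S_pos by (simp add: \<theta>_def)

lemma fro_sqrt_dmin_le_S: "F * sqrt dmin \<le> S"
proof -
  have "F * sqrt dmin \<le> sqrt S * sqrt S"
    using fro_sq_le_S dmin_le_S dmin_pos by (intro mult_mono) (auto simp: real_le_rsqrt)
  then show ?thesis
    using S_pos by simp
qed

lemma theta_le_1: "\<theta> \<le> 1"
proof -
  have "\<sigma> * sqrt dmin \<le> F * sqrt dmin"
    using sigma_le_fro dmin_pos by (intro mult_right_mono) auto
  then show ?thesis
    using fro_sqrt_dmin_le_S S_pos by (simp add: \<theta>_def)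
qed

lemma ark_beta_eq: "ark_beta \<mu> \<nu> = 1 - \<theta>"
proof -
  have "\<mu> / \<nu> = \<theta>\<^sup>2"
    using S_pos dmin_pos by (simp add: mu_eq nu_eq \<theta>_def power_divide power_mult_distrib power2_eq_square)
  then show ?thesis
    using theta_pos by (simp add: ark_beta_def)
qed

lemma ark_gamma_eq: "ark_gamma \<mu> \<nu> = sqrt dmin / \<sigma>"
proof -
  have "\<mu> * \<nu> = \<sigma>\<^sup>2 / dmin"
    using S_pos by (simp add: mu_eq nu_eq)
  then show ?thesis
    using sigma_pos by (simp add: ark_gamma_def real_sqrt_divide)
qed

lemma ark_gamma_nu: "ark_gamma \<mu> \<nu> * \<nu> = 1 / \<theta>"
proof -
  have "sqrt dmin * (S / dmin) = S / sqrt dmin"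
    using dmin_pos by (simp add: field_simps)
  have "sqrt dmin / \<sigma> * (S / dmin) = sqrt dmin * (S / dmin) / \<sigma>"
    by simp
  also have "\<dots> = S / sqrt dmin / \<sigma>"
    by (simp only: \<open>sqrt dmin * (S / dmin) = S / sqrt dmin\<close>)
  finally show ?thesis
    unfolding ark_gamma_eq unfolding nu_eq \<theta>_def by (simp add: mult.commute)
qed

lemma ark_alpha_eq: "ark_alpha \<mu> \<nu> = \<theta> / (1 + \<theta>)"
  unfolding ark_alpha_def ark_gamma_nu using theta_pos by (simp add: field_simps)

lemma one_minus_ark_alpha_eq: "1 - ark_alpha \<mu> \<nu> = 1 / (1 + \<theta>)"
  unfolding ark_alpha_eq using theta_pos by (simp add: field_simps)

text \<open>All that the two admissible choices of \<open>lam\<close> have to provide: the total weight \<open>S\<close> stays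
  comparable to \<open>F\<^sup>2\<close>, and the smallest weight \<open>dmin\<close> is at least of the order of the average
  \<open>S / n\<close>.\<close>

lemma option_S_le:
  assumes "ark_option A lam"
  shows "S \<le> 2 * F\<^sup>2" and "S \<le> 2 * F * (sqrt (real n) * sqrt dmin)"
proof -
  have n: "0 < real n"
    using n_pos by simp
  have key: "F \<le> c * (sqrt (real n) * sqrt dmin)" if "0 \<le> c" "F\<^sup>2 \<le> c\<^sup>2 * (real n * dmin)" for c
  proof (rule power2_le_imp_le)
    show "F\<^sup>2 \<le> (c * (sqrt (real n) * sqrt dmin))\<^sup>2"
      using that dmin_pos by (simp add: power_mult_distrib)
  qed (use that dmin_pos in auto)
  have "S \<le> 2 * F\<^sup>2 \<and> S \<le> 2 * F * (sqrt (real n) * sqrt dmin)"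
  proof (cases "lam = F\<^sup>2 / real n")
    case True
    have "real n * lam = F\<^sup>2"
      using n by (subst True) simp
    then have S_eq: "S = 2 * F\<^sup>2"
      by (simp add: S_def)
    have "lam \<le> dmin"
      using min_row_sq_pos by (simp add: dmin_def)
    then have "F\<^sup>2 \<le> 1\<^sup>2 * (real n * dmin)"
      using n by (simp add: True field_simps)
    then have "F \<le> sqrt (real n) * sqrt dmin"
      using key[of 1] by simp
    then have "2 * F * F \<le> 2 * F * (sqrt (real n) * sqrt dmin)"
      using fro_pos by (intro mult_left_mono) auto
    then show ?thesis
      by (simp add: S_eq power2_eq_square)
  next
    case False
    then have lam0: "lam = 0" and opt: "max_row_sq A \<le> 4 * min_row_sq A"
      using assms by (auto simp: ark_option_def)
    have "real n * lam = 0"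
      by (subst lam0) simp
    then have S_eq: "S = F\<^sup>2"
      by (simp add: S_def)
    have dmin_eq: "dmin = min_row_sq A"
      unfolding dmin_def by (subst lam0) simp
    have "row_sq A i \<le> max_row_sq A" if "i < n" for i
      using that by (auto simp: max_row_sq_def intro!: Max_ge)
    then have "(\<Sum>i<n. row_sq A i) \<le> (\<Sum>i<n. 4 * dmin)"
      using opt dmin_eq by (intro sum_mono) force
    then have "F\<^sup>2 \<le> 2\<^sup>2 * (real n * dmin)"
      using sum_row_sq[of A] by simp
    then have "F * F \<le> F * (2 * (sqrt (real n) * sqrt dmin))"
      using key[of 2] fro_pos by (intro mult_left_mono) auto
    then show ?thesis
      by (simp add: S_eq power2_eq_square mult_ac)
  qed
  then show "S \<le> 2 * F\<^sup>2" "S \<le> 2 * F * (sqrt (real n) * sqrt dmin)"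
    by auto
qed

lemma ark_gamma_le:
  assumes "ark_option A lam"
  shows "ark_gamma \<mu> \<nu> \<le> 2 * \<kappa>"
proof -
  have "dmin \<le> (2 * F)\<^sup>2"
    using option_S_le(1)[OF assms] dmin_le_S zero_le_power2[of F]
    unfolding power_mult_distrib power2_eq_square[of 2] by linarith
  then have "sqrt dmin \<le> 2 * F"
    using fro_pos by (intro real_le_lsqrt) auto
  then have "sqrt dmin / \<sigma> \<le> 2 * F / \<sigma>"
    using sigma_pos by (intro divide_right_mono) auto
  then show ?thesis
    using fro_over_sigma_le_cond unfolding ark_gamma_eq by simp
qed

lemma theta_ge:
  assumes "ark_option A lam"
  shows "1 / (2 * \<kappa> * sqrt (real n)) \<le> \<theta>"
proof -
  have sn: "0 < sqrt (real n)"
    using n_pos by simp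
  have "F * 1 \<le> \<kappa> * \<sigma>"
    using fro_over_sigma_le_cond sigma_pos by (simp add: field_simps)
  then have "2 * (sqrt (real n) * sqrt dmin) * F \<le> 2 * (sqrt (real n) * sqrt dmin) * (\<kappa> * \<sigma>)"
    using dmin_pos by (intro mult_left_mono) auto
  then have "S \<le> \<sigma> * sqrt dmin * (2 * \<kappa> * sqrt (real n))"
    using option_S_le(2)[OF assms] by (simp add: mult_ac)
  then show ?thesis
    using S_pos sn cond_ge_1 by (simp add: \<theta>_def field_simps)
qed

text \<open>This is \<open>\<mu>\<close> times the usual potential, the squared norm of \<open>v\<close> for the inverse of \<open>H\<close> plus the
  squared norm of \<open>y\<close> divided by \<open>\<mu>\<close>.  In this scaling it is comparable to a squared error.\<close>

definition potential :: "real vec \<Rightarrow> real vec \<Rightarrow> real" where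
  "potential v y = \<sigma>\<^sup>2 * (l2_norm (lift v))\<^sup>2 + (l2_norm y)\<^sup>2"

text \<open>The step is linear in the errors: for \<open>x\<close> the distance of the extrapolated point to the
  solution, the update of row \<open>i\<close> is this multiple of the row.\<close>

definition coeff :: "nat \<Rightarrow> real vec \<Rightarrow> real" where
  "coeff i x = (row A i \<bullet> x) / d i"

text \<open>The update is at most a projection, since \<open>d i\<close> is at least the squared norm of row \<open>i\<close>, so in
  the mean the squared error decreases by at least the energy \<open>|A x|\<^sup>2 / S\<close>.  The next lemma shows that the
  momentum vector pays at most this energy.\<close>

lemma mean_sq_primal_step:
  assumes x: "x \<in> carrier_vec n"
  shows "(\<Sum>i<n. d i / S * (l2_norm (x - coeff i x \<cdot>\<^sub>v row A i))\<^sup>2)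
    \<le> (l2_norm x)\<^sup>2 - (l2_norm (A *\<^sub>v x))\<^sup>2 / S"
proof -
  have "d i / S * (l2_norm (x - coeff i x \<cdot>\<^sub>v row A i))\<^sup>2
      \<le> d i / S * (l2_norm x)\<^sup>2 - (row A i \<bullet> x)\<^sup>2 / S" if i: "i < n" for i
  proof -
    have eq: "x - coeff i x \<cdot>\<^sub>v row A i = x + (- coeff i x) \<cdot>\<^sub>v row A i"
      using x by (intro eq_vecI) auto
    have comm: "x \<bullet> row A i = row A i \<bullet> x"
      using comm_scalar_prod[OF x row_carrier[of i]] .
    have "(coeff i x)\<^sup>2 * (l2_norm (row A i))\<^sup>2 \<le> (coeff i x)\<^sup>2 * d i"
      using lam_nonneg by (intro mult_left_mono) (auto simp: d_def row_sq_def)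
    also have "\<dots> = coeff i x * (row A i \<bullet> x)"
      using d_pos[OF i] by (simp add: coeff_def power2_eq_square)
    finally have "(coeff i x)\<^sup>2 * (l2_norm (row A i))\<^sup>2 \<le> coeff i x * (row A i \<bullet> x)" .
    then have "(l2_norm (x - coeff i x \<cdot>\<^sub>v row A i))\<^sup>2
        \<le> (l2_norm x)\<^sup>2 - coeff i x * (row A i \<bullet> x)"
      unfolding eq l2_norm_add_smult_sq[OF x row_carrier[of i]] comm by (simp add: mult.commute)
    then have "d i / S * (l2_norm (x - coeff i x \<cdot>\<^sub>v row A i))\<^sup>2
        \<le> d i / S * ((l2_norm x)\<^sup>2 - coeff i x * (row A i \<bullet> x))"
      using d_pos[OF i] S_pos by (intro mult_left_mono) auto
    then show ?thesis
      using d_pos[OF i] by (simp add: coeff_def power2_eq_square right_diff_distrib)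
  qed
  then have "(\<Sum>i<n. d i / S * (l2_norm (x - coeff i x \<cdot>\<^sub>v row A i))\<^sup>2)
      \<le> (\<Sum>i<n. d i / S * (l2_norm x)\<^sup>2 - (row A i \<bullet> x)\<^sup>2 / S)"
    by (intro sum_mono) auto
  also have "\<dots> = (l2_norm x)\<^sup>2 - (l2_norm (A *\<^sub>v x))\<^sup>2 / S"
    using S_pos by (simp add: sum_subtractf sum_distrib_right[symmetric] sum_divide_distrib[symmetric]
        sum_d l2_norm_mult_mat_vec_sq)
  finally show ?thesis .
qed

text \<open>In lifted coordinates row \<open>i\<close> acts on the \<open>i\<close>-th entry alone.  Hence the cross terms sum to the
  inner product of \<open>lift q\<close> with \<open>A x\<close>, which is that of \<open>q\<close> with \<open>x\<close>, and the quadratic terms to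
  a weighted norm of \<open>A x\<close>; \<open>g\<close> is the value of \<open>\<gamma>\<close>, for which the latter is at most the energy.\<close>

lemma mean_sq_momentum_step:
  assumes q: "q \<in> carrier_vec n" and x: "x \<in> carrier_vec n" and g: "g = sqrt dmin / \<sigma>"
  shows "(\<Sum>i<n. d i / S * (\<sigma>\<^sup>2 * (l2_norm (lift (q - g \<cdot>\<^sub>v (coeff i x \<cdot>\<^sub>v row A i))))\<^sup>2))
    \<le> \<sigma>\<^sup>2 * (l2_norm (lift q))\<^sup>2 - 2 * \<theta> * (x \<bullet> q) + (l2_norm (A *\<^sub>v x))\<^sup>2 / S"
proof -
  have "d i / S * (\<sigma>\<^sup>2 * (l2_norm (lift (q - g \<cdot>\<^sub>v (coeff i x \<cdot>\<^sub>v row A i))))\<^sup>2)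
      \<le> d i / S * (\<sigma>\<^sup>2 * (l2_norm (lift q))\<^sup>2) - 2 * \<theta> * (lift q $ i * (row A i \<bullet> x))
        + (row A i \<bullet> x)\<^sup>2 / S" if i: "i < n" for i
  proof -
    let ?r = "row A i \<bullet> x" and ?c = "coeff i x"
    have "q - g \<cdot>\<^sub>v (?c \<cdot>\<^sub>v row A i) = q + (- (g * ?c)) \<cdot>\<^sub>v row A i"
      using q by (intro eq_vecI) auto
    then have "lift (q - g \<cdot>\<^sub>v (?c \<cdot>\<^sub>v row A i)) = lift q + (- (g * ?c)) \<cdot>\<^sub>v unit_vec n i"
      using q i by (simp add: lift_add lift_smult lift_row)
    moreover have "l2_norm (unit_vec n i) = 1" "lift q \<bullet> unit_vec n i = lift q $ i"
      using i lift_carrier[OF q] by (simp_all add: l2_norm_def)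
    ultimately have "(l2_norm (lift (q - g \<cdot>\<^sub>v (?c \<cdot>\<^sub>v row A i))))\<^sup>2 =
        (l2_norm (lift q))\<^sup>2 - 2 * g * ?c * (lift q $ i) + g\<^sup>2 * ?c\<^sup>2"
      using q by (simp add: l2_norm_add_smult_sq[of _ n] power_mult_distrib)
    note sq = this
    have "d i / S * (\<sigma>\<^sup>2 * (l2_norm (lift (q - g \<cdot>\<^sub>v (?c \<cdot>\<^sub>v row A i))))\<^sup>2) =
        d i / S * (\<sigma>\<^sup>2 * (l2_norm (lift q))\<^sup>2) - 2 * (\<sigma>\<^sup>2 * g / S) * ((d i * ?c) * (lift q $ i))
        + (\<sigma> * g)\<^sup>2 / S * ((d i * ?c) * ?c)"
      unfolding sq by (simp add: algebra_simps power2_eq_square diff_divide_distrib add_divide_distrib)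
    also have "d i * ?c = ?r"
      using d_pos[OF i] by (simp add: coeff_def)
    also have "\<sigma>\<^sup>2 * g / S = \<theta>"
      using sigma_pos by (simp add: g \<theta>_def power2_eq_square)
    also have "(\<sigma> * g)\<^sup>2 = dmin"
      using sigma_pos dmin_pos by (simp add: g)
    also have "dmin / S * (?r * ?c) \<le> ?r\<^sup>2 / S"
    proof -
      have "dmin * (?r * ?c) \<le> d i * (?r * ?c)"
        using dmin_le[OF i] d_pos[OF i] by (intro mult_right_mono) (auto simp: coeff_def)
      also have "\<dots> = ?r\<^sup>2"
        using d_pos[OF i] by (simp add: coeff_def power2_eq_square)
      finally show ?thesis
        using S_pos by (simp add: divide_right_mono)
    qed
    finally show ?thesis
      by (simp add: mult_ac)
  qed
  then have "(\<Sum>i<n. d i / S * (\<sigma>\<^sup>2 * (l2_norm (lift (q - g \<cdot>\<^sub>v (coeff i x \<cdot>\<^sub>v row A i))))\<^sup>2))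
      \<le> (\<Sum>i<n. d i / S * (\<sigma>\<^sup>2 * (l2_norm (lift q))\<^sup>2) - 2 * \<theta> * (lift q $ i * (row A i \<bullet> x))
        + (row A i \<bullet> x)\<^sup>2 / S)"
    by (intro sum_mono) auto
  also have "\<dots> = \<sigma>\<^sup>2 * (l2_norm (lift q))\<^sup>2 - 2 * \<theta> * (\<Sum>i<n. lift q $ i * (row A i \<bullet> x))
      + (l2_norm (A *\<^sub>v x))\<^sup>2 / S"
  proof -
    have "(\<Sum>i<n. d i / S * (\<sigma>\<^sup>2 * (l2_norm (lift q))\<^sup>2)) = \<sigma>\<^sup>2 * (l2_norm (lift q))\<^sup>2"
      using S_pos by (simp only: sum_distrib_right[symmetric] sum_divide_distrib[symmetric] sum_d) simp
    then show ?thesis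
      by (simp only: sum.distrib sum_subtractf sum_distrib_left sum_divide_distrib
          l2_norm_mult_mat_vec_sq dims)
  qed
  also have "(\<Sum>i<n. lift q $ i * (row A i \<bullet> x)) = x \<bullet> q"
  proof -
    have "(\<Sum>i<n. lift q $ i * (row A i \<bullet> x)) = lift q \<bullet> (A *\<^sub>v x)"
      by (simp add: scalar_prod_def[of "lift q"] lessThan_atLeast0)
    then show ?thesis
      using lift_scalar_prod[OF q x] comm_scalar_prod[OF q x] by simp
  qed
  finally show ?thesis .
qed

text \<open>The energies of the two preceding lemmas cancel.  What remains is an inner product of \<open>x\<close> and \<open>q\<close>,
  which the identity \<open>(1 + \<theta>) x = \<theta> v + y\<close> expresses by \<open>x\<close> and \<open>y\<close>; then the coefficient of the
  squared norm of \<open>x\<close> is \<open>- (1 - \<theta>)\<close> and is used up by the mixed term.\<close>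

lemma mean_potential_step:
  assumes v: "v \<in> carrier_vec n" and y: "y \<in> carrier_vec n"
    and x_def: "x = ark_alpha \<mu> \<nu> \<cdot>\<^sub>v v + (1 - ark_alpha \<mu> \<nu>) \<cdot>\<^sub>v y"
    and q_def: "q = ark_beta \<mu> \<nu> \<cdot>\<^sub>v v + (1 - ark_beta \<mu> \<nu>) \<cdot>\<^sub>v x"
  shows "(\<Sum>i<n. d i / S * potential (q - ark_gamma \<mu> \<nu> \<cdot>\<^sub>v (coeff i x \<cdot>\<^sub>v row A i))
                                   (x - coeff i x \<cdot>\<^sub>v row A i))
    \<le> (1 - \<theta>) * potential v y"
proof -
  have x: "x \<in> carrier_vec n" and q: "q \<in> carrier_vec n"
    using v y by (auto simp: x_def q_def)
  have q_eq: "q = (1 - \<theta>) \<cdot>\<^sub>v v + \<theta> \<cdot>\<^sub>v x"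
    by (simp add: q_def ark_beta_eq)
  have th: "0 < 1 + \<theta>"
    using theta_pos by simp
  \<comment> \<open>\<open>\<alpha> = \<theta> / (1 + \<theta>)\<close>, so this is the identity for the extrapolated point, tested with \<open>x\<close>.\<close>
  have x_v: "(1 + \<theta>) * (x \<bullet> x) = \<theta> * (x \<bullet> v) + x \<bullet> y"
  proof -
    have "x \<bullet> x = (\<theta> * (x \<bullet> v) + x \<bullet> y) / (1 + \<theta>)"
      by (subst (2) x_def, subst one_minus_ark_alpha_eq, subst ark_alpha_eq)
        (use x v y in \<open>simp add: scalar_prod_add_distrib[of _ n] add_divide_distrib\<close>)
    then show ?thesis
      using th by (simp add: field_simps)
  qed
  have x_q: "x \<bullet> q = (1 - \<theta>) * (x \<bullet> v) + \<theta> * (x \<bullet> x)"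
    unfolding q_eq using x v by (simp add: scalar_prod_add_distrib[of _ n])
  have conv: "\<sigma>\<^sup>2 * (l2_norm (lift q))\<^sup>2
      \<le> (1 - \<theta>) * (\<sigma>\<^sup>2 * (l2_norm (lift v))\<^sup>2) + \<theta> * (l2_norm x)\<^sup>2"
  proof -
    have "(l2_norm (lift q))\<^sup>2 \<le> (1 - \<theta>) * (l2_norm (lift v))\<^sup>2 + \<theta> * (l2_norm (lift x))\<^sup>2"
      unfolding q_eq using v x theta_pos theta_le_1
      by (simp add: lift_add lift_smult l2_norm_sq_convex[of _ n])
    then have "\<sigma>\<^sup>2 * (l2_norm (lift q))\<^sup>2
        \<le> \<sigma>\<^sup>2 * ((1 - \<theta>) * (l2_norm (lift v))\<^sup>2 + \<theta> * (l2_norm (lift x))\<^sup>2)"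
      by (intro mult_left_mono) auto
    moreover have "\<theta> * (\<sigma> * l2_norm (lift x))\<^sup>2 \<le> \<theta> * (l2_norm x)\<^sup>2"
      using theta_pos sigma_lift_le[OF x] sigma_pos by (intro mult_left_mono power_mono) auto
    ultimately show ?thesis
      by (simp add: algebra_simps power_mult_distrib)
  qed
  have "(\<Sum>i<n. d i / S * potential (q - ark_gamma \<mu> \<nu> \<cdot>\<^sub>v (coeff i x \<cdot>\<^sub>v row A i))
                                   (x - coeff i x \<cdot>\<^sub>v row A i))
      = (\<Sum>i<n. d i / S * (\<sigma>\<^sup>2 * (l2_norm (lift (q - ark_gamma \<mu> \<nu> \<cdot>\<^sub>v (coeff i x \<cdot>\<^sub>v row A i))))\<^sup>2))
        + (\<Sum>i<n. d i / S * (l2_norm (x - coeff i x \<cdot>\<^sub>v row A i))\<^sup>2)"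
    by (simp only: potential_def distrib_left sum.distrib)
  also have "\<dots> \<le> \<sigma>\<^sup>2 * (l2_norm (lift q))\<^sup>2 - 2 * \<theta> * (x \<bullet> q) + (l2_norm x)\<^sup>2"
    using mean_sq_momentum_step[OF q x ark_gamma_eq] mean_sq_primal_step[OF x] by linarith
  also have "\<dots> \<le> (1 - \<theta>) * (\<sigma>\<^sup>2 * (l2_norm (lift v))\<^sup>2) + (1 + \<theta>) * (l2_norm x)\<^sup>2
      - 2 * \<theta> * (x \<bullet> q)"
    using conv by (simp add: algebra_simps)
  also have "2 * \<theta> * (x \<bullet> q) = 2 * (1 - \<theta>) * (\<theta> * (x \<bullet> v)) + 2 * \<theta>\<^sup>2 * (x \<bullet> x)"
    unfolding x_q by (simp add: algebra_simps power2_eq_square)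
  also have "\<theta> * (x \<bullet> v) = (1 + \<theta>) * (x \<bullet> x) - x \<bullet> y"
    using x_v by simp
  also have "(1 - \<theta>) * (\<sigma>\<^sup>2 * (l2_norm (lift v))\<^sup>2) + (1 + \<theta>) * (l2_norm x)\<^sup>2
      - (2 * (1 - \<theta>) * ((1 + \<theta>) * (x \<bullet> x) - x \<bullet> y) + 2 * \<theta>\<^sup>2 * (x \<bullet> x))
      = (1 - \<theta>) * (\<sigma>\<^sup>2 * (l2_norm (lift v))\<^sup>2 + 2 * (x \<bullet> y) - (l2_norm x)\<^sup>2)"
    by (simp add: l2_norm_sq[symmetric] algebra_simps power2_eq_square)
  also have "\<dots> \<le> (1 - \<theta>) * potential v y"
    unfolding potential_def using two_scalar_prod_le[OF x y] theta_le_1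
    by (intro mult_left_mono) auto
  finally show ?thesis .
qed

end

section \<open>Rounding errors of the vector operations\<close>

lemma one_plus_power_minus_one_le:
  assumes "0 \<le> u" "real n * u \<le> 1"
  shows "(1 + u) ^ n - 1 \<le> 2 * (real n * u)"
proof -
  have "(1 + u) ^ n \<le> exp u ^ n"
    using assms(1) exp_ge_add_one_self[of u] by (intro power_mono) auto
  also have "\<dots> = exp (real n * u)"
    by (simp add: exp_of_nat_mult)
  also have "\<dots> \<le> 1 + real n * u + (real n * u)\<^sup>2"
    using assms by (intro exp_bound) auto
  also have "(real n * u)\<^sup>2 \<le> real n * u"
    using assms by (simp add: power2_eq_square mult_left_le)
  finally have "(1 + u) ^ n \<le> 1 + real n * u + real n * u"
    by simp
  then show ?thesis by linarith
qed

text \<open>The hypothesis \<open>u \<le> 1\<close> bounds every factor \<open>1 + u\<close> by 2, which is where the factors 2 in the bounds for the vector operations come from.\<close>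

locale fp_model =
  fixes M :: fp_arith and u :: real and n :: nat
  assumes model: "standard_model M u" and u_le_1: "u \<le> 1"
begin

definition fp_vectors :: "real vec set" where
  "fp_vectors = {x \<in> carrier_vec n. \<forall>i<n. x $ i \<in> fp_repr M}"

lemma fp_vectors_carrier: "x \<in> fp_vectors \<Longrightarrow> x \<in> carrier_vec n"
  by (simp add: fp_vectors_def)

lemma u_pos: "0 < u"
  using model by (simp add: standard_model_def)

lemma zero_repr: "0 \<in> fp_repr M"
proof -
  have "fp_round M 0 \<in> fp_repr M" "\<bar>fp_round M 0 - 0\<bar> \<le> u * \<bar>0\<bar>"
    using model unfolding standard_model_def by blast+
  then show ?thesis by simp
qed

lemma zero_fp_vectors: "0\<^sub>v n \<in> fp_vectors"
  by (simp add: fp_vectors_def zero_repr)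

lemma fp_ops:
  assumes "a \<in> fp_repr M" "b \<in> fp_repr M"
  shows "fp_add M a b \<in> fp_repr M" "\<bar>fp_add M a b - (a + b)\<bar> \<le> u * \<bar>a + b\<bar>"
    and "fp_sub M a b \<in> fp_repr M" "\<bar>fp_sub M a b - (a - b)\<bar> \<le> u * \<bar>a - b\<bar>"
    and "fp_mul M a b \<in> fp_repr M" "\<bar>fp_mul M a b - a * b\<bar> \<le> u * \<bar>a * b\<bar>"
    and "b \<noteq> 0 \<Longrightarrow> fp_div M a b \<in> fp_repr M" "b \<noteq> 0 \<Longrightarrow> \<bar>fp_div M a b - a / b\<bar> \<le> u * \<bar>a / b\<bar>"
  using model assms unfolding standard_model_def by blast+

text \<open>The common pattern of the operations below: \<open>z\<close> is the rounded value of \<open>w'\<close>, the exact result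
  on inputs that are themselves inexact, and \<open>w\<close> is the result on the intended inputs.\<close>

lemma l2_norm_approx_trans:
  assumes "z \<in> carrier_vec n" "w \<in> carrier_vec n" "w' \<in> carrier_vec n"
    and "l2_norm (z - w') \<le> u * l2_norm w'" and "l2_norm (w' - w) \<le> e" and "l2_norm w \<le> b"
  shows "l2_norm (z - w) \<le> 2 * e + u * b"
proof -
  have e: "0 \<le> e"
    using assms(5) l2_norm_nonneg[of "w' - w"] by linarith
  have "z - w = (z - w') + (w' - w)"
    using assms(1-3) by (intro eq_vecI) auto
  then have "l2_norm (z - w) \<le> l2_norm (z - w') + l2_norm (w' - w)"
    using l2_norm_triangle[of "z - w'" n "w' - w"] assms(1-3) by simp
  moreover have "l2_norm w' \<le> e + b"
  proof -
    have "w' = (w' - w) + w"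
      using assms(2,3) by (intro eq_vecI) auto
    then show ?thesis
      using l2_norm_triangle[of "w' - w" n w] assms by simp
  qed
  then have "u * l2_norm w' \<le> u * (e + b)"
    using u_pos by (intro mult_left_mono) auto
  moreover have "u * e \<le> e"
    using u_le_1 e by (simp add: mult_left_le_one_le u_pos less_imp_le)
  ultimately show ?thesis
    using assms(4,5) by (simp add: distrib_left)
qed

lemma fp_vec_add_closed:
  "x \<in> fp_vectors \<Longrightarrow> y \<in> fp_vectors \<Longrightarrow> fp_vec_add M x y \<in> fp_vectors"
  and fp_vec_sub_closed:
  "x \<in> fp_vectors \<Longrightarrow> y \<in> fp_vectors \<Longrightarrow> fp_vec_sub M x y \<in> fp_vectors"
  by (auto simp: fp_vectors_def fp_vec_add_def fp_vec_sub_def fp_ops)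

lemma fp_scale_closed: "t \<in> fp_repr M \<Longrightarrow> x \<in> fp_vectors \<Longrightarrow> fp_scale M t x \<in> fp_vectors"
  by (auto simp: fp_vectors_def fp_scale_def fp_ops)

lemma fp_vec_add_error:
  assumes "x' \<in> fp_vectors" "y' \<in> fp_vectors" and xy: "x \<in> carrier_vec n" "y \<in> carrier_vec n"
    and "l2_norm (x' - x) \<le> ex" "l2_norm (y' - y) \<le> ey" "l2_norm (x + y) \<le> b"
  shows "l2_norm (fp_vec_add M x' y' - (x + y)) \<le> 2 * (ex + ey) + u * b"
proof (rule l2_norm_approx_trans)
  note c = assms(1,2)[THEN fp_vectors_carrier]
  show "fp_vec_add M x' y' \<in> carrier_vec n"
    by (intro fp_vectors_carrier fp_vec_add_closed assms)
  show "x + y \<in> carrier_vec n" "x' + y' \<in> carrier_vec n"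
    using xy c by auto
  show "l2_norm (fp_vec_add M x' y' - (x' + y')) \<le> u * l2_norm (x' + y')"
    by (rule l2_norm_le_componentwise[of _ n])
      (use assms(1,2) c u_pos in \<open>auto simp: fp_vec_add_def fp_vectors_def fp_ops\<close>)
  have "x' + y' - (x + y) = (x' - x) + (y' - y)"
    using xy c by (intro eq_vecI) auto
  then show "l2_norm (x' + y' - (x + y)) \<le> ex + ey"
    using l2_norm_triangle[of "x' - x" n "y' - y"] xy c assms(5,6) by simp
qed (rule assms)

lemma fp_vec_sub_error:
  assumes "x' \<in> fp_vectors" "y' \<in> fp_vectors" and xy: "x \<in> carrier_vec n" "y \<in> carrier_vec n"
    and "l2_norm (x' - x) \<le> ex" "l2_norm (y' - y) \<le> ey" "l2_norm (x - y) \<le> b"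
  shows "l2_norm (fp_vec_sub M x' y' - (x - y)) \<le> 2 * (ex + ey) + u * b"
proof (rule l2_norm_approx_trans)
  note c = assms(1,2)[THEN fp_vectors_carrier]
  show "fp_vec_sub M x' y' \<in> carrier_vec n"
    by (intro fp_vectors_carrier fp_vec_sub_closed assms)
  show "x - y \<in> carrier_vec n" "x' - y' \<in> carrier_vec n"
    using xy c by auto
  show "l2_norm (fp_vec_sub M x' y' - (x' - y')) \<le> u * l2_norm (x' - y')"
    by (rule l2_norm_le_componentwise[of _ n])
      (use assms(1,2) c u_pos in \<open>auto simp: fp_vec_sub_def fp_vectors_def fp_ops\<close>)
  have "x' - y' - (x - y) = (x' - x) - (y' - y)"
    using xy c by (intro eq_vecI) auto
  then show "l2_norm (x' - y' - (x - y)) \<le> ex + ey"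
    using l2_norm_diff_le[of "x' - x" n "y' - y"] xy c assms(5,6) by simp
qed (rule assms)

lemma fp_scale_error:
  assumes "t \<in> fp_repr M" "x' \<in> fp_vectors" "x \<in> carrier_vec n"
    and "l2_norm (x' - x) \<le> ex" "l2_norm x \<le> b"
  shows "l2_norm (fp_scale M t x' - t \<cdot>\<^sub>v x) \<le> \<bar>t\<bar> * (2 * ex + u * b)"
proof -
  note c = assms(2)[THEN fp_vectors_carrier]
  have "l2_norm (fp_scale M t x' - t \<cdot>\<^sub>v x) \<le> 2 * (\<bar>t\<bar> * ex) + u * (\<bar>t\<bar> * b)"
  proof (rule l2_norm_approx_trans)
    show "fp_scale M t x' \<in> carrier_vec n"
      by (intro fp_vectors_carrier fp_scale_closed assms)
    show "t \<cdot>\<^sub>v x \<in> carrier_vec n" "t \<cdot>\<^sub>v x' \<in> carrier_vec n"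
      using assms(3) c by auto
    show "l2_norm (fp_scale M t x' - t \<cdot>\<^sub>v x') \<le> u * l2_norm (t \<cdot>\<^sub>v x')"
      by (rule l2_norm_le_componentwise[of _ n])
        (use assms(1,2) c u_pos in \<open>auto simp: fp_scale_def fp_vectors_def fp_ops simp del: l2_norm_smult\<close>)
    have "t \<cdot>\<^sub>v x' - t \<cdot>\<^sub>v x = t \<cdot>\<^sub>v (x' - x)"
      using assms(3) c by (intro eq_vecI) (auto simp: right_diff_distrib)
    then show "l2_norm (t \<cdot>\<^sub>v x' - t \<cdot>\<^sub>v x) \<le> \<bar>t\<bar> * ex"
      using assms(4) by (simp add: mult_left_mono)
    show "l2_norm (t \<cdot>\<^sub>v x) \<le> \<bar>t\<bar> * b"
      using assms(5) by (simp add: mult_left_mono)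
  qed
  then show ?thesis
    by (simp add: algebra_simps)
qed

text \<open>Here the scalar is inexact and the vector is exact, as for the step along a row.\<close>

lemma fp_scale_scalar_error:
  assumes "t' \<in> fp_repr M" "a \<in> fp_vectors"
    and "\<bar>t' - t\<bar> \<le> e" "\<bar>t\<bar> \<le> b"
  shows "l2_norm (fp_scale M t' a - t \<cdot>\<^sub>v a) \<le> (2 * e + u * b) * l2_norm a"
proof -
  note c = assms(2)[THEN fp_vectors_carrier]
  have "l2_norm (fp_scale M t' a - t \<cdot>\<^sub>v a) \<le> 2 * (e * l2_norm a) + u * (b * l2_norm a)"
  proof (rule l2_norm_approx_trans)
    show "fp_scale M t' a \<in> carrier_vec n"
      by (intro fp_vectors_carrier fp_scale_closed assms)
    show "t \<cdot>\<^sub>v a \<in> carrier_vec n" "t' \<cdot>\<^sub>v a \<in> carrier_vec n"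
      using c by auto
    show "l2_norm (fp_scale M t' a - t' \<cdot>\<^sub>v a) \<le> u * l2_norm (t' \<cdot>\<^sub>v a)"
      by (rule l2_norm_le_componentwise[of _ n])
        (use assms(1,2) c u_pos in \<open>auto simp: fp_scale_def fp_vectors_def fp_ops simp del: l2_norm_smult\<close>)
    have "t' \<cdot>\<^sub>v a - t \<cdot>\<^sub>v a = (t' - t) \<cdot>\<^sub>v a"
      using c by (intro eq_vecI) (auto simp: left_diff_distrib)
    then show "l2_norm (t' \<cdot>\<^sub>v a - t \<cdot>\<^sub>v a) \<le> e * l2_norm a"
      using assms(3) by (simp add: mult_right_mono)
    show "l2_norm (t \<cdot>\<^sub>v a) \<le> b * l2_norm a"
      using assms(4) by (simp add: mult_right_mono)
  qed
  then show ?thesis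
    by (simp add: algebra_simps)
qed

lemma fp_dot_prefix_error:
  assumes "x \<in> fp_vectors" "y \<in> fp_vectors" "i < n"
  shows "fp_dot_prefix M x y i \<in> fp_repr M \<and>
    \<bar>fp_dot_prefix M x y i - (\<Sum>j\<le>i. x $ j * y $ j)\<bar>
      \<le> ((1 + u) ^ Suc i - 1) * (\<Sum>j\<le>i. \<bar>x $ j * y $ j\<bar>)"
  using assms(3)
proof (induction i)
  case 0
  then show ?case
    using assms(1,2) by (auto simp: fp_vectors_def fp_ops)
next
  case (Suc i)
  define p where "p = fp_dot_prefix M x y i"
  define m where "m = fp_mul M (x $ Suc i) (y $ Suc i)"
  define t where "t = x $ Suc i * y $ Suc i"
  define s where "s = (\<Sum>j\<le>i. x $ j * y $ j)"
  define T where "T = (\<Sum>j\<le>i. \<bar>x $ j * y $ j\<bar>)"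
  define g where "g = (1 + u) ^ Suc i"
  have p: "p \<in> fp_repr M" "\<bar>p - s\<bar> \<le> (g - 1) * T"
    using Suc by (auto simp: p_def s_def T_def g_def)
  have m: "m \<in> fp_repr M" "\<bar>m - t\<bar> \<le> u * \<bar>t\<bar>"
    using assms(1,2) Suc.prems by (auto simp: m_def t_def fp_vectors_def fp_ops)
  have add: "fp_add M p m \<in> fp_repr M" "\<bar>fp_add M p m - (p + m)\<bar> \<le> u * \<bar>p + m\<bar>"
    using fp_ops[OF p(1) m(1)] by auto
  have "\<bar>s\<bar> \<le> T"
    unfolding s_def T_def by (rule sum_abs)
  then have "\<bar>p + m\<bar> \<le> g * T + (1 + u) * \<bar>t\<bar>"
    using p(2) m(2) by (simp add: algebra_simps)
  then have "u * \<bar>p + m\<bar> \<le> u * (g * T + (1 + u) * \<bar>t\<bar>)"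
    using u_pos by (intro mult_left_mono) auto
  then have "\<bar>fp_add M p m - (s + t)\<bar> \<le> (g - 1) * T + u * \<bar>t\<bar> + u * (g * T + (1 + u) * \<bar>t\<bar>)"
    using add(2) p(2) m(2) by linarith
  also have "\<dots> = ((1 + u) * g - 1) * T + ((1 + u) * (1 + u) - 1) * \<bar>t\<bar>"
    by (simp add: algebra_simps)
  also have "\<dots> \<le> ((1 + u) * g - 1) * T + ((1 + u) * g - 1) * \<bar>t\<bar>"
  proof -
    have "(1 + u) ^ 1 \<le> g"
      unfolding g_def using u_pos by (intro power_increasing) auto
    then have "(1 + u) * (1 + u) \<le> (1 + u) * g"
      using u_pos by (intro mult_left_mono) auto
    then show ?thesis
      by (intro add_left_mono mult_right_mono) auto
  qed
  finally show ?case
    using add(1) by (simp add: p_def m_def s_def t_def T_def g_def algebra_simps)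
qed

lemma fp_dot_closed:
  assumes "x \<in> fp_vectors" "y \<in> fp_vectors" "0 < n"
  shows "fp_dot M x y \<in> fp_repr M"
  using fp_dot_prefix_error[OF assms(1,2), of "n - 1"] assms(3) fp_vectors_carrier[OF assms(1)]
  by (simp add: fp_dot_def)

lemma fp_dot_error:
  assumes "x \<in> fp_vectors" "y \<in> fp_vectors" "0 < n" "real n * u \<le> 1"
  shows "\<bar>fp_dot M x y - x \<bullet> y\<bar> \<le> 2 * (real n * u) * (l2_norm x * l2_norm y)"
proof -
  note c = assms(1,2)[THEN fp_vectors_carrier]
  have n: "{..n - 1} = {..<n}" "Suc (n - 1) = n"
    using assms(3) by auto
  have "\<bar>fp_dot M x y - x \<bullet> y\<bar> \<le> ((1 + u) ^ n - 1) * (\<Sum>j<n. \<bar>x $ j * y $ j\<bar>)"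
    using fp_dot_prefix_error[OF assms(1,2), of "n - 1"] c assms(3)
    unfolding n by (simp add: fp_dot_def scalar_prod_def lessThan_atLeast0)
  also have "\<dots> \<le> 2 * (real n * u) * (\<Sum>j<n. \<bar>x $ j * y $ j\<bar>)"
    using one_plus_power_minus_one_le[of u n] u_pos assms(4) by (intro mult_right_mono sum_nonneg) auto
  also have "\<dots> \<le> 2 * (real n * u) * (l2_norm x * l2_norm y)"
    using sum_abs_prod_le_l2_norm[OF c] u_pos by (intro mult_left_mono) auto
  finally show ?thesis .
qed

lemma approx_scalar_trans:
  assumes "\<bar>z - w'\<bar> \<le> u * \<bar>w'\<bar>" "\<bar>w' - w\<bar> \<le> e" "\<bar>w\<bar> \<le> b"
  shows "\<bar>z - w\<bar> \<le> 2 * e + u * (b::real)"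
proof -
  have "u * \<bar>w'\<bar> \<le> u * (e + b)"
    using assms(2,3) u_pos by (intro mult_left_mono) auto
  moreover have "u * e \<le> e"
    using u_le_1 assms(2) by (simp add: mult_left_le_one_le u_pos less_imp_le)
  ultimately show ?thesis
    using assms(1,2) by (simp add: distrib_left)
qed

end

lemma quotient_perturbation:
  fixes N N' D D' :: real
  assumes "0 < D" "\<bar>N' - N\<bar> \<le> eN" "\<bar>N\<bar> \<le> b" "\<bar>D' - D\<bar> \<le> eD * D" "eD \<le> 1 / 2"
  shows "\<bar>N' / D' - N / D\<bar> \<le> 2 * (eN + b * eD) / D" and "0 < D'"
proof -
  have eD: "0 \<le> eD"
  proof -
    have "0 \<le> eD * D"
      using assms(4) by linarith
    then show ?thesis
      using assms(1) by (simp add: zero_le_mult_iff)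
  qed
  have "eD * D \<le> 1 / 2 * D"
    using assms(1,5) by (intro mult_right_mono) auto
  then have D': "D / 2 \<le> D'"
    using assms(4) by linarith
  then show pos: "0 < D'"
    using assms(1) by linarith
  have "\<bar>(N' - N) * D - N * (D' - D)\<bar> \<le> eN * D + b * (eD * D)"
  proof -
    have "\<bar>(N' - N) * D\<bar> \<le> eN * D" "\<bar>N * (D' - D)\<bar> \<le> b * (eD * D)"
      using assms by (auto simp: abs_mult intro!: mult_mono)
    then show ?thesis by linarith
  qed
  moreover have "N' / D' - N / D = ((N' - N) * D - N * (D' - D)) / (D' * D)"
    using pos assms(1) by (simp add: field_simps)
  ultimately have "\<bar>N' / D' - N / D\<bar> \<le> (eN * D + b * (eD * D)) / (D' * D)"
    using pos assms(1) by (simp add: divide_right_mono)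
  also have "\<dots> = (eN + b * eD) / D'"
    using assms(1) pos by (simp add: field_simps)
  also have "\<dots> \<le> (eN + b * eD) / (D / 2)"
    using D' assms eD by (intro divide_left_mono) auto
  finally show "\<bar>N' / D' - N / D\<bar> \<le> 2 * (eN + b * eD) / D"
    by (simp add: mult_ac)
qed

section \<open>One computed step\<close>

text \<open>The constant 60000 is chosen for \<open>noise_bounds\<close>: the part of the rounding errors that is
  proportional to the potential must not exceed a quarter of the contraction gap.\<close>

locale kaczmarz_fp = kaczmarz A n lam + fp_model M u n
  for A n lam M u +
  fixes b :: "real vec"
  assumes b: "b \<in> carrier_vec n"
    and data_repr: "ark_data_repr M A b lam (ark_mu A lam) (ark_nu A lam)"
    and option: "ark_option A lam"
    and small_cond: "(demmel_cond A)\<^sup>2 * u \<le> 1 / (60000 * (real n)\<^sup>2)"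
begin

lemma small: "real n * u \<le> 1 / 100"
proof -
  have n1: "1 \<le> real n"
    using n_pos by simp
  have "1 * u \<le> \<kappa>\<^sup>2 * u"
    using cond_ge_1 u_pos by (intro mult_right_mono) (auto simp: one_le_power)
  then have "u \<le> 1 / (60000 * (real n)\<^sup>2)"
    using small_cond by linarith
  then have "real n * u \<le> real n * (1 / (60000 * (real n)\<^sup>2))"
    by (intro mult_left_mono) auto
  also have "\<dots> = 1 / (60000 * real n)"
    by (simp add: power2_eq_square)
  also have "\<dots> \<le> 1 / 100"
    using n1 by (intro divide_left_mono) auto
  finally show ?thesis .
qed

lemma gamma_le: "ark_gamma \<mu> \<nu> \<le> 2 * \<kappa>"
  by (rule ark_gamma_le[OF option])

abbreviation "\<alpha> \<equiv> ark_alpha \<mu> \<nu>"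
abbreviation "\<beta> \<equiv> ark_beta \<mu> \<nu>"
abbreviation "\<gamma> \<equiv> ark_gamma \<mu> \<nu>"

definition sol :: "real vec" where "sol = mat_inv A *\<^sub>v b"

definition \<eta> :: real where "\<eta> = real n * u"

lemma sol_carrier [simp]: "sol \<in> carrier_vec n"
  by (simp add: sol_def b)

lemma row_sol: "i < n \<Longrightarrow> row A i \<bullet> sol = b $ i"
  using mult_inv_vec[OF b] index_mult_mat_vec[of i A sol] by (simp add: sol_def)

lemma eta: "u \<le> \<eta>" "0 < \<eta>" "\<eta> \<le> 1 / 100"
proof -
  have "1 * u \<le> real n * u"
    using n_pos u_pos by (intro mult_right_mono) auto
  then show "u \<le> \<eta>" by (simp add: \<eta>_def)
  then show "0 < \<eta>" using u_pos by linarith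
  show "\<eta> \<le> 1 / 100" using small by (simp add: \<eta>_def)
qed

lemma row_fp: "i < n \<Longrightarrow> row A i \<in> fp_vectors"
  using data_repr b by (auto simp: ark_data_repr_def fp_vectors_def)

lemma params_repr: "\<alpha> \<in> fp_repr M" "1 - \<alpha> \<in> fp_repr M" "\<beta> \<in> fp_repr M" "1 - \<beta> \<in> fp_repr M"
    "\<gamma> \<in> fp_repr M" "lam \<in> fp_repr M" "i < n \<Longrightarrow> b $ i \<in> fp_repr M"
  using data_repr b by (auto simp: ark_data_repr_def)

lemma params_bounds: "0 \<le> \<alpha>" "0 \<le> 1 - \<alpha>" "1 - \<alpha> \<le> 1" "0 \<le> \<beta>" "\<beta> \<le> 1" "0 \<le> \<gamma>"
  using theta_pos theta_le_1 sigma_pos dmin_pos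
  by (auto simp: one_minus_ark_alpha_eq ark_alpha_eq ark_beta_eq ark_gamma_eq)

text \<open>The results of one step computed exactly from the given pair: the extrapolated point, the
  averaged momentum vector, and the update of row \<open>i\<close>.\<close>

definition exact_x :: "real vec \<Rightarrow> real vec \<Rightarrow> real vec" where
  "exact_x v y = \<alpha> \<cdot>\<^sub>v v + (1 - \<alpha>) \<cdot>\<^sub>v y"

definition exact_q :: "real vec \<Rightarrow> real vec \<Rightarrow> real vec" where
  "exact_q v y = \<beta> \<cdot>\<^sub>v v + (1 - \<beta>) \<cdot>\<^sub>v exact_x v y"

definition exact_w :: "nat \<Rightarrow> real vec \<Rightarrow> real vec \<Rightarrow> real vec" where
  "exact_w i v y = coeff i (exact_x v y - sol) \<cdot>\<^sub>v row A i"

lemma exact_carrier [simp]: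
  assumes "v \<in> carrier_vec n" "y \<in> carrier_vec n"
  shows "exact_x v y \<in> carrier_vec n" "exact_q v y \<in> carrier_vec n" "exact_w i v y \<in> carrier_vec n"
  using assms by (auto simp: exact_x_def exact_q_def exact_w_def)

text \<open>The number \<open>R\<close> bounds every vector that enters a step, except the momentum vector itself,
  which is only bounded by \<open>\<kappa> R\<close>; it enters \<open>x\<close> with the small weight \<open>\<alpha>\<close>.\<close>

definition bounded_state :: "real \<Rightarrow> real vec \<Rightarrow> real vec \<Rightarrow> bool" where
  "bounded_state R v y \<longleftrightarrow> v \<in> fp_vectors \<and> y \<in> fp_vectors \<and>
     \<alpha> * l2_norm v \<le> R \<and> l2_norm y \<le> R \<and> l2_norm v \<le> \<kappa> * R \<and> l2_norm sol \<le> R"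

context
  fixes R v y
  assumes bs: "bounded_state R v y"
begin

lemma fpv: "v \<in> fp_vectors" "y \<in> fp_vectors"
  and vc [simp]: "v \<in> carrier_vec n" "y \<in> carrier_vec n"
  using bs fp_vectors_carrier by (auto simp: bounded_state_def)

lemma state_norms_le: "\<alpha> * l2_norm v \<le> R" "l2_norm y \<le> R" "l2_norm v \<le> \<kappa> * R" "l2_norm sol \<le> R"
  using bs by (auto simp: bounded_state_def)

lemma R_nonneg: "0 \<le> R"
  using state_norms_le(4) l2_norm_nonneg[of sol] by linarith

lemma y_part_le: "(1 - \<alpha>) * l2_norm y \<le> R"
  using params_bounds state_norms_le(2) mult_left_le_one_le[of "l2_norm y" "1 - \<alpha>"] by simp

lemma exact_x_le: "l2_norm (exact_x v y) \<le> 2 * R"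
  using l2_norm_triangle[of "\<alpha> \<cdot>\<^sub>v v" n "(1 - \<alpha>) \<cdot>\<^sub>v y"] state_norms_le(1) y_part_le params_bounds
  by (simp add: exact_x_def)

lemma fp_x_fp: "fp_ark_x M \<mu> \<nu> (v, y) \<in> fp_vectors"
  unfolding fp_ark_x_def by (simp add: fp_vec_add_closed fp_scale_closed params_repr fpv)

lemma fp_x_error: "l2_norm (fp_ark_x M \<mu> \<nu> (v, y) - exact_x v y) \<le> 6 * u * R"
proof -
  have "l2_norm (fp_ark_x M \<mu> \<nu> (v, y) - exact_x v y) \<le> 2 * (u * R + u * R) + u * (2 * R)"
    unfolding fp_ark_x_def exact_x_def prod.case
  proof (rule fp_vec_add_error)
    have "l2_norm (fp_scale M \<alpha> v - \<alpha> \<cdot>\<^sub>v v) \<le> \<bar>\<alpha>\<bar> * (2 * 0 + u * l2_norm v)"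
      using fpv params_repr by (intro fp_scale_error) auto
    also have "\<dots> = u * (\<alpha> * l2_norm v)"
      using params_bounds by simp
    also have "\<dots> \<le> u * R"
      using state_norms_le(1) u_pos by (intro mult_left_mono) auto
    finally show "l2_norm (fp_scale M \<alpha> v - \<alpha> \<cdot>\<^sub>v v) \<le> u * R" .
    have "l2_norm (fp_scale M (1 - \<alpha>) y - (1 - \<alpha>) \<cdot>\<^sub>v y) \<le> \<bar>1 - \<alpha>\<bar> * (2 * 0 + u * l2_norm y)"
      using fpv params_repr by (intro fp_scale_error) auto
    also have "\<dots> = u * ((1 - \<alpha>) * l2_norm y)"
      using params_bounds by simp
    also have "\<dots> \<le> u * R"
      using y_part_le u_pos by (intro mult_left_mono) auto
    finally show "l2_norm (fp_scale M (1 - \<alpha>) y - (1 - \<alpha>) \<cdot>\<^sub>v y) \<le> u * R" .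
    show "l2_norm (\<alpha> \<cdot>\<^sub>v v + (1 - \<alpha>) \<cdot>\<^sub>v y) \<le> 2 * R"
      using exact_x_le by (simp add: exact_x_def)
  qed (auto intro!: fp_scale_closed params_repr fpv)
  then show ?thesis
    by (simp add: mult_ac)
qed

abbreviation "xc \<equiv> fp_ark_x M \<mu> \<nu> (v, y)"

lemma xc_carrier [simp]: "xc \<in> carrier_vec n"
  using fp_x_fp by (rule fp_vectors_carrier)

lemma uR: "0 \<le> u * R" "u * R \<le> \<eta> * R" "\<eta> * R \<le> R / 100"
  using R_nonneg u_pos eta mult_right_mono[OF eta(1) R_nonneg] mult_right_mono[OF eta(3) R_nonneg]
  by auto

lemma xc_le: "l2_norm xc \<le> 3 * R"
proof -
  have "xc = (xc - exact_x v y) + exact_x v y"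
    by (intro eq_vecI) (auto simp: carrier_vecD[OF xc_carrier] carrier_vecD[OF exact_carrier(1)[OF vc]])
  then have "l2_norm xc \<le> 6 * (u * R) + 2 * R"
    using l2_norm_triangle[of "xc - exact_x v y" n "exact_x v y"] fp_x_error exact_x_le by simp
  then show ?thesis
    using uR R_nonneg by linarith
qed

lemma exact_residual_le: "l2_norm (exact_x v y - sol) \<le> 3 * R"
  using l2_norm_diff_le[of "exact_x v y" n sol] exact_x_le state_norms_le(4) by simp

text \<open>The computed coefficient of the row in a step; \<open>coeff\<close> is its exact counterpart.\<close>

definition tc :: "nat \<Rightarrow> real" where
  "tc i = fp_div M (fp_sub M (fp_dot M (row A i) xc) (b $ i)) (fp_add M (fp_dot M (row A i) (row A i)) lam)"

lemma l2_row_sq_le_d: "(l2_norm (row A i))\<^sup>2 \<le> d i"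
  using lam_nonneg by (simp add: d_def row_sq_def)

text \<open>All errors are measured in units of \<open>h = |a| R\<close>, since the exact numerator is the inner product
  of the row \<open>a\<close> with a vector of norm at most \<open>3 R\<close>.\<close>

lemma tc_error:
  assumes i: "i < n"
  shows "tc i \<in> fp_repr M"
    and "\<bar>tc i - coeff i (exact_x v y - sol)\<bar> \<le> 171 * (\<eta> * R) * (l2_norm (row A i) / d i)"
    and "\<bar>coeff i (exact_x v y - sol)\<bar> \<le> 3 * R * (l2_norm (row A i) / d i)"
proof -
  let ?a = "row A i" and ?x = "exact_x v y"
  define na where "na = l2_norm ?a"
  define h where "h = na * R"
  define N where "N = ?a \<bullet> (?x - sol)"
  define N' where "N' = fp_sub M (fp_dot M ?a xc) (b $ i)"
  define D' where "D' = fp_add M (fp_dot M ?a ?a) lam"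
  have na: "0 \<le> na" by (simp add: na_def)
  have h: "0 \<le> h" "u * h \<le> \<eta> * h" "0 \<le> u * h"
    using na R_nonneg u_pos mult_right_mono[OF eta(1), of h] by (auto simp: h_def)
  have n1: "real n * u \<le> 1" using small by simp
  have dotr: "fp_dot M ?a xc \<in> fp_repr M" "fp_dot M ?a ?a \<in> fp_repr M"
    using fp_dot_closed row_fp[OF i] fp_x_fp n_pos by auto
  have N_eq: "N = ?a \<bullet> ?x - b $ i"
    using row_sol[OF i] by (simp add: N_def scalar_prod_minus_distrib[of _ n])
  have N_le: "\<bar>N\<bar> \<le> 3 * h"
  proof -
    have "\<bar>N\<bar> \<le> na * l2_norm (?x - sol)"
      unfolding N_def na_def by (rule abs_scalar_prod_le[of _ n]) auto
    also have "\<dots> \<le> na * (3 * R)"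
      using exact_residual_le na by (intro mult_left_mono)
    finally show ?thesis by (simp add: h_def)
  qed
  have dot_err: "\<bar>fp_dot M ?a xc - ?a \<bullet> ?x\<bar> \<le> 12 * (\<eta> * h)"
  proof -
    have "\<bar>fp_dot M ?a xc - ?a \<bullet> xc\<bar> \<le> 2 * (real n * u) * (na * l2_norm xc)"
      unfolding na_def by (rule fp_dot_error) (use row_fp[OF i] fp_x_fp n_pos n1 in auto)
    also have "\<dots> \<le> 2 * \<eta> * (na * (3 * R))"
      unfolding \<eta>_def[symmetric] using xc_le na eta by (intro mult_left_mono) auto
    finally have 1: "\<bar>fp_dot M ?a xc - ?a \<bullet> xc\<bar> \<le> 6 * (\<eta> * h)"
      by (simp add: h_def)
    have "?a \<bullet> xc - ?a \<bullet> ?x = ?a \<bullet> (xc - ?x)"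
      by (simp add: scalar_prod_minus_distrib[of _ n])
    also have "\<bar>\<dots>\<bar> \<le> na * l2_norm (xc - ?x)"
      unfolding na_def by (rule abs_scalar_prod_le[of _ n]) auto
    also have "\<dots> \<le> na * (6 * u * R)"
      using fp_x_error na by (intro mult_left_mono)
    also have "\<dots> = 6 * (u * h)"
      by (simp add: h_def)
    finally show ?thesis
      using 1 h by linarith
  qed
  have N': "N' \<in> fp_repr M" "\<bar>N' - N\<bar> \<le> 27 * (\<eta> * h)"
  proof -
    show "N' \<in> fp_repr M"
      unfolding N'_def using dotr(1) params_repr(7)[OF i] by (rule fp_ops)
    have "\<bar>N' - N\<bar> \<le> 2 * (12 * (\<eta> * h)) + u * (3 * h)"
    proof (rule approx_scalar_trans)
      show "\<bar>N' - (fp_dot M ?a xc - b $ i)\<bar> \<le> u * \<bar>fp_dot M ?a xc - b $ i\<bar>"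
        unfolding N'_def using dotr(1) params_repr(7)[OF i] by (rule fp_ops)
      show "\<bar>fp_dot M ?a xc - b $ i - N\<bar> \<le> 12 * (\<eta> * h)"
        using dot_err by (simp add: N_eq)
    qed (rule N_le)
    then show "\<bar>N' - N\<bar> \<le> 27 * (\<eta> * h)"
      using h by linarith
  qed
  have D': "D' \<in> fp_repr M" "\<bar>D' - d i\<bar> \<le> 5 * \<eta> * d i"
  proof -
    show "D' \<in> fp_repr M"
      unfolding D'_def using dotr(2) params_repr(6) by (rule fp_ops)
    have "\<bar>fp_dot M ?a ?a - ?a \<bullet> ?a\<bar> \<le> 2 * (real n * u) * (l2_norm ?a * l2_norm ?a)"
      by (rule fp_dot_error) (use row_fp[OF i] n_pos n1 in auto)
    also have "\<dots> \<le> 2 * \<eta> * d i"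
      unfolding \<eta>_def[symmetric] using l2_row_sq_le_d[of i] eta
      by (intro mult_left_mono) (auto simp: power2_eq_square)
    finally have 1: "\<bar>fp_dot M ?a ?a - ?a \<bullet> ?a\<bar> \<le> 2 * \<eta> * d i" .
    have d_eq: "d i = ?a \<bullet> ?a + lam"
      by (simp add: d_def row_sq_def l2_norm_sq)
    have "\<bar>D' - d i\<bar> \<le> 2 * (2 * \<eta> * d i) + u * d i"
    proof (rule approx_scalar_trans)
      show "\<bar>D' - (fp_dot M ?a ?a + lam)\<bar> \<le> u * \<bar>fp_dot M ?a ?a + lam\<bar>"
        unfolding D'_def using dotr(2) params_repr(6) by (rule fp_ops)
      show "\<bar>fp_dot M ?a ?a + lam - d i\<bar> \<le> 2 * \<eta> * d i"
        using 1 by (simp add: d_eq)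
      show "\<bar>d i\<bar> \<le> d i"
        using d_pos[OF i] by simp
    qed
    moreover have "u * d i \<le> \<eta> * d i"
      using eta d_pos[OF i] by (intro mult_right_mono) auto
    ultimately show "\<bar>D' - d i\<bar> \<le> 5 * \<eta> * d i"
      by linarith
  qed
  have quot: "\<bar>N' / D' - N / d i\<bar> \<le> 2 * (27 * (\<eta> * h) + 3 * h * (5 * \<eta>)) / d i" "0 < D'"
    using quotient_perturbation[OF d_pos[OF i] N'(2) N_le D'(2)] eta by auto
  have tc_eq: "tc i = fp_div M N' D'"
    by (simp add: tc_def N'_def D'_def)
  have coeff_eq: "coeff i (?x - sol) = N / d i"
    by (simp add: coeff_def N_def)
  show "tc i \<in> fp_repr M"
    unfolding tc_eq using N'(1) D'(1) quot(2) by (intro fp_ops) auto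
  have "\<bar>N\<bar> / d i \<le> 3 * h / d i"
    using N_le d_pos[OF i] by (intro divide_right_mono) auto
  then have cb: "\<bar>N / d i\<bar> \<le> 3 * (h / d i)"
    using d_pos[OF i] by simp
  then show "\<bar>coeff i (?x - sol)\<bar> \<le> 3 * R * (l2_norm ?a / d i)"
    by (simp add: coeff_eq h_def na_def mult_ac)
  have "\<bar>tc i - N / d i\<bar> \<le> 2 * (84 * (\<eta> * (h / d i))) + u * (3 * (h / d i))"
    unfolding tc_eq
  proof (rule approx_scalar_trans)
    show "\<bar>fp_div M N' D' - N' / D'\<bar> \<le> u * \<bar>N' / D'\<bar>"
      using N'(1) D'(1) quot(2) by (intro fp_ops) auto
    have "2 * (27 * (\<eta> * h) + 3 * h * (5 * \<eta>)) / d i = 84 * (\<eta> * (h / d i))"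
      by (simp add: field_simps)
    with quot(1) show "\<bar>N' / D' - N / d i\<bar> \<le> 84 * (\<eta> * (h / d i))"
      by (simp only:)
  qed (rule cb)
  also have "\<dots> \<le> 2 * (84 * (\<eta> * (h / d i))) + \<eta> * (3 * (h / d i))"
    using eta h d_pos[OF i] by (intro add_left_mono mult_right_mono) auto
  also have "\<dots> = 171 * (\<eta> * (h / d i))"
    by simp
  finally have "\<bar>tc i - N / d i\<bar> \<le> 171 * (\<eta> * (h / d i))" .
  then show "\<bar>tc i - coeff i (?x - sol)\<bar> \<le> 171 * (\<eta> * R) * (l2_norm ?a / d i)"
    by (simp add: coeff_eq h_def na_def mult_ac)
qed

lemma w_bounds:
  assumes i: "i < n"
  shows "fp_scale M (tc i) (row A i) \<in> fp_vectors"
    and "l2_norm (fp_scale M (tc i) (row A i) - exact_w i v y) \<le> 345 * (\<eta> * R)"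
    and "l2_norm (exact_w i v y) \<le> 3 * R"
proof -
  let ?a = "row A i"
  have frac: "(l2_norm ?a / d i) * l2_norm ?a \<le> 1" "0 \<le> (l2_norm ?a / d i) * l2_norm ?a"
    using l2_row_sq_le_d[of i] d_pos[OF i] by (auto simp: power2_eq_square)
  show "fp_scale M (tc i) ?a \<in> fp_vectors"
    using tc_error(1)[OF i] row_fp[OF i] by (rule fp_scale_closed)
  have "l2_norm (fp_scale M (tc i) ?a - exact_w i v y)
      \<le> (2 * (171 * (\<eta> * R) * (l2_norm ?a / d i)) + u * (3 * R * (l2_norm ?a / d i))) * l2_norm ?a"
    unfolding exact_w_def using tc_error[OF i] row_fp[OF i] by (intro fp_scale_scalar_error)
  also have "\<dots> = (342 * (\<eta> * R) + 3 * (u * R)) * ((l2_norm ?a / d i) * l2_norm ?a)"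
    by (simp add: algebra_simps)
  also have "\<dots> \<le> (342 * (\<eta> * R) + 3 * (u * R)) * 1"
    using frac uR by (intro mult_left_mono) auto
  also have "\<dots> = 342 * (\<eta> * R) + 3 * (u * R)"
    by simp
  also have "\<dots> \<le> 345 * (\<eta> * R)"
    using uR by linarith
  finally show "l2_norm (fp_scale M (tc i) ?a - exact_w i v y) \<le> 345 * (\<eta> * R)" .
  have "l2_norm (exact_w i v y) \<le> (3 * R * (l2_norm ?a / d i)) * l2_norm ?a"
    unfolding exact_w_def l2_norm_smult using tc_error(3)[OF i] by (intro mult_right_mono) auto
  also have "\<dots> = 3 * R * ((l2_norm ?a / d i) * l2_norm ?a)"
    by simp
  also have "\<dots> \<le> 3 * R * 1"
    using frac R_nonneg by (intro mult_left_mono) auto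
  finally show "l2_norm (exact_w i v y) \<le> 3 * R"
    by simp
qed

lemma fp_step_eq:
  "fp_ark_step M A b lam \<mu> \<nu> i (v, y) =
    (fp_vec_sub M (fp_vec_add M (fp_scale M \<beta> v) (fp_scale M (1 - \<beta>) xc))
       (fp_scale M \<gamma> (fp_scale M (tc i) (row A i))),
     fp_vec_sub M xc (fp_scale M (tc i) (row A i)))"
  by (simp add: fp_ark_step_def tc_def Let_def)

lemma fp_step_closed:
  assumes i: "i < n"
  shows "fst (fp_ark_step M A b lam \<mu> \<nu> i (v, y)) \<in> fp_vectors"
    and "snd (fp_ark_step M A b lam \<mu> \<nu> i (v, y)) \<in> fp_vectors"
  unfolding fp_step_eq fst_conv snd_conv
  by (intro fp_vec_sub_closed fp_vec_add_closed fp_scale_closed params_repr fpv fp_x_fp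
      tc_error(1) row_fp i)+

lemma fp_step_y_error:
  assumes i: "i < n"
  shows "l2_norm (snd (fp_ark_step M A b lam \<mu> \<nu> i (v, y)) - (exact_x v y - exact_w i v y))
    \<le> 707 * (\<eta> * R)"
proof -
  have "l2_norm (exact_x v y - exact_w i v y) \<le> 5 * R"
    using l2_norm_diff_le[of "exact_x v y" n "exact_w i v y"] exact_x_le w_bounds(3)[OF i] by simp
  then have "l2_norm (snd (fp_ark_step M A b lam \<mu> \<nu> i (v, y)) - (exact_x v y - exact_w i v y))
      \<le> 2 * (6 * u * R + 345 * (\<eta> * R)) + u * (5 * R)"
    (is "?e \<le> _") unfolding fp_step_eq snd_conv using w_bounds[OF i] fp_x_fp fp_x_error
    by (intro fp_vec_sub_error) auto
  also have "2 * (6 * u * R + 345 * (\<eta> * R)) + u * (5 * R) = 17 * (u * R) + 690 * (\<eta> * R)"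
    by simp
  finally have "?e \<le> 17 * (u * R) + 690 * (\<eta> * R)" .
  then show ?thesis
    using uR(2) by linarith
qed

lemma kappa_eta_R: "\<eta> * R \<le> \<eta> * \<kappa> * R" "u * R \<le> \<eta> * \<kappa> * R" "u * \<kappa> * R \<le> \<eta> * \<kappa> * R" "R \<le> \<kappa> * R"
proof -
  show R: "R \<le> \<kappa> * R"
    using mult_right_mono[OF cond_ge_1 R_nonneg] by simp
  then show 1: "\<eta> * R \<le> \<eta> * \<kappa> * R"
    using mult_left_mono[OF R, of \<eta>] eta by (simp add: mult_ac)
  then show "u * R \<le> \<eta> * \<kappa> * R"
    using uR by linarith
  show "u * \<kappa> * R \<le> \<eta> * \<kappa> * R"
    using eta R R_nonneg mult_right_mono[OF eta(1), of "\<kappa> * R"] by (simp add: mult_ac)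
qed

lemma q_bounds:
  shows "l2_norm (fp_vec_add M (fp_scale M \<beta> v) (fp_scale M (1 - \<beta>) xc) - exact_q v y)
      \<le> 33 * (\<eta> * \<kappa> * R)"
    and "l2_norm (exact_q v y) \<le> 3 * (\<kappa> * R)"
proof -
  have bv: "\<beta> * l2_norm v \<le> \<kappa> * R"
    using params_bounds mult_left_le_one_le[of "l2_norm v" \<beta>] state_norms_le(3) by simp
  have bx: "(1 - \<beta>) * t \<le> t" if "0 \<le> t" for t
    using params_bounds that by (simp add: mult_left_le_one_le)
  have q_le: "l2_norm (exact_q v y) \<le> \<kappa> * R + 2 * R"
    using l2_norm_triangle[of "\<beta> \<cdot>\<^sub>v v" n "(1 - \<beta>) \<cdot>\<^sub>v exact_x v y"] bv
      bx[of "l2_norm (exact_x v y)"] exact_x_le params_bounds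
    by (simp add: exact_q_def)
  then show "l2_norm (exact_q v y) \<le> 3 * (\<kappa> * R)"
    using kappa_eta_R(4) by linarith
  have "l2_norm (fp_vec_add M (fp_scale M \<beta> v) (fp_scale M (1 - \<beta>) xc) - exact_q v y)
      \<le> 2 * (u * (\<kappa> * R) + 14 * (u * R)) + u * (\<kappa> * R + 2 * R)"
    (is "?e \<le> _") unfolding exact_q_def
  proof (rule fp_vec_add_error)
    have "l2_norm (fp_scale M \<beta> v - \<beta> \<cdot>\<^sub>v v) \<le> \<bar>\<beta>\<bar> * (2 * 0 + u * l2_norm v)"
      using fpv params_repr by (intro fp_scale_error) auto
    also have "\<dots> = u * (\<beta> * l2_norm v)"
      using params_bounds by simp
    also have "\<dots> \<le> u * (\<kappa> * R)"
      using bv u_pos by (intro mult_left_mono) auto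
    finally show "l2_norm (fp_scale M \<beta> v - \<beta> \<cdot>\<^sub>v v) \<le> u * (\<kappa> * R)" .
    have "l2_norm (fp_scale M (1 - \<beta>) xc - (1 - \<beta>) \<cdot>\<^sub>v exact_x v y)
        \<le> \<bar>1 - \<beta>\<bar> * (2 * (6 * u * R) + u * (2 * R))"
      using fp_x_fp fp_x_error exact_x_le params_repr by (intro fp_scale_error) auto
    also have "\<dots> = (1 - \<beta>) * (14 * (u * R))"
      using params_bounds by simp
    also have "\<dots> \<le> 14 * (u * R)"
      using uR by (intro bx) auto
    finally show "l2_norm (fp_scale M (1 - \<beta>) xc - (1 - \<beta>) \<cdot>\<^sub>v exact_x v y) \<le> 14 * (u * R)" .
    show "l2_norm (\<beta> \<cdot>\<^sub>v v + (1 - \<beta>) \<cdot>\<^sub>v exact_x v y) \<le> \<kappa> * R + 2 * R"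
      using q_le by (simp add: exact_q_def)
  qed (auto intro!: fp_scale_closed params_repr fpv fp_x_fp)
  also have "\<dots> = 3 * (u * \<kappa> * R) + 30 * (u * R)"
    by (simp add: algebra_simps)
  also have "\<dots> \<le> 33 * (\<eta> * \<kappa> * R)"
    using kappa_eta_R(2,3) by linarith
  finally show "?e \<le> 33 * (\<eta> * \<kappa> * R)" .
qed

text \<open>The worst contribution: the error of the update is amplified by \<open>\<gamma> \<le> 2 \<kappa>\<close>.\<close>

lemma fp_step_v_error:
  assumes i: "i < n"
  shows "l2_norm (fst (fp_ark_step M A b lam \<mu> \<nu> i (v, y)) - (exact_q v y - \<gamma> \<cdot>\<^sub>v exact_w i v y))
    \<le> 2847 * (\<eta> * \<kappa> * R)"
proof -
  have g: "\<gamma> * t \<le> 2 * \<kappa> * t" if "0 \<le> t" for t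
    using gamma_le that by (intro mult_right_mono) auto
  have "l2_norm (fp_scale M \<gamma> (fp_scale M (tc i) (row A i)) - \<gamma> \<cdot>\<^sub>v exact_w i v y)
      \<le> \<bar>\<gamma>\<bar> * (2 * (345 * (\<eta> * R)) + u * (3 * R))"
    using w_bounds[OF i] params_repr by (intro fp_scale_error) auto
  also have "\<dots> = \<gamma> * (690 * (\<eta> * R) + 3 * (u * R))"
    using params_bounds by simp
  also have "\<dots> \<le> 2 * \<kappa> * (690 * (\<eta> * R) + 3 * (u * R))"
    using uR by (intro g) auto
  also have "\<dots> \<le> 2 * \<kappa> * (693 * (\<eta> * R))"
  proof (intro mult_left_mono)
    show "690 * (\<eta> * R) + 3 * (u * R) \<le> 693 * (\<eta> * R)"
      using uR by linarith
  qed (use cond_ge_1 in auto)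
  finally have w_err: "l2_norm (fp_scale M \<gamma> (fp_scale M (tc i) (row A i)) - \<gamma> \<cdot>\<^sub>v exact_w i v y)
      \<le> 1386 * (\<eta> * \<kappa> * R)"
    by (simp add: mult_ac)
  have "\<gamma> * l2_norm (exact_w i v y) \<le> 2 * \<kappa> * l2_norm (exact_w i v y)"
    by (rule g) auto
  also have "\<dots> \<le> 2 * \<kappa> * (3 * R)"
    using w_bounds(3)[OF i] cond_ge_1 by (intro mult_left_mono) auto
  finally have "l2_norm (exact_q v y - \<gamma> \<cdot>\<^sub>v exact_w i v y) \<le> 9 * (\<kappa> * R)"
    using l2_norm_diff_le[of "exact_q v y" n "\<gamma> \<cdot>\<^sub>v exact_w i v y"] q_bounds(2) params_bounds by simp
  then have "l2_norm (fst (fp_ark_step M A b lam \<mu> \<nu> i (v, y)) - (exact_q v y - \<gamma> \<cdot>\<^sub>v exact_w i v y))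
      \<le> 2 * (33 * (\<eta> * \<kappa> * R) + 1386 * (\<eta> * \<kappa> * R)) + u * (9 * (\<kappa> * R))"
    unfolding fp_step_eq fst_conv using q_bounds(1) w_err
    by (intro fp_vec_sub_error fp_vec_add_closed fp_scale_closed params_repr fpv fp_x_fp
        tc_error(1) row_fp i) auto
  then show ?thesis
    using kappa_eta_R(3) by (simp add: mult_ac)
qed

end

end

section \<open>Mean contraction of the computed iteration\<close>

context kaczmarz_fp
begin

lemma potential_nonneg: "0 \<le> potential v y"
  by (simp add: potential_def)

lemma potential_add_le:
  assumes "v \<in> carrier_vec n" "y \<in> carrier_vec n" "v' \<in> carrier_vec n" "y' \<in> carrier_vec n" "0 < e"
  shows "potential (v + v') (y + y')
    \<le> (1 + e) * potential v y + (1 + 1 / e) * ((l2_norm v')\<^sup>2 + (l2_norm y')\<^sup>2)"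
proof -
  have "(\<sigma> * l2_norm (lift v'))\<^sup>2 \<le> (l2_norm v')\<^sup>2"
    using sigma_lift_le[OF assms(3)] sigma_pos by (intro power_mono) auto
  then have 1: "(1 + 1 / e) * (\<sigma>\<^sup>2 * (l2_norm (lift v'))\<^sup>2) \<le> (1 + 1 / e) * (l2_norm v')\<^sup>2"
    using assms(5) by (intro mult_left_mono) (auto simp: power_mult_distrib)
  have "(l2_norm (lift v + lift v'))\<^sup>2 \<le> (1 + e) * (l2_norm (lift v))\<^sup>2 + (1 + 1 / e) * (l2_norm (lift v'))\<^sup>2"
    by (rule l2_norm_sq_add_le[of _ n]) (use assms in auto)
  then have "\<sigma>\<^sup>2 * (l2_norm (lift v + lift v'))\<^sup>2
      \<le> \<sigma>\<^sup>2 * ((1 + e) * (l2_norm (lift v))\<^sup>2 + (1 + 1 / e) * (l2_norm (lift v'))\<^sup>2)"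
    by (intro mult_left_mono) auto
  also have "\<dots> = (1 + e) * (\<sigma>\<^sup>2 * (l2_norm (lift v))\<^sup>2) + (1 + 1 / e) * (\<sigma>\<^sup>2 * (l2_norm (lift v'))\<^sup>2)"
    by (simp add: algebra_simps)
  finally have 2: "\<sigma>\<^sup>2 * (l2_norm (lift (v + v')))\<^sup>2
      \<le> (1 + e) * (\<sigma>\<^sup>2 * (l2_norm (lift v))\<^sup>2) + (1 + 1 / e) * (l2_norm v')\<^sup>2"
    using 1 assms by (simp add: lift_add)
  have 3: "(l2_norm (y + y'))\<^sup>2 \<le> (1 + e) * (l2_norm y)\<^sup>2 + (1 + 1 / e) * (l2_norm y')\<^sup>2"
    by (rule l2_norm_sq_add_le[of _ n]) (use assms in auto)
  show ?thesis
    using 2 3 unfolding potential_def distrib_left by linarith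
qed

definition state_potential :: "real vec \<times> real vec \<Rightarrow> real" where
  "state_potential s = potential (fst s - sol) (snd s - sol)"

lemma state_potential_nonneg: "0 \<le> state_potential s"
  by (simp add: state_potential_def potential_nonneg)

text \<open>The potential controls \<open>y\<close> directly, but the momentum vector only through its lifting, which
  costs \<open>F / \<sigma> \<le> \<kappa>\<close>.  The weight \<open>\<alpha> \<le> \<theta>\<close> compensates this loss.\<close>

lemma state_bounds:
  assumes "v \<in> carrier_vec n" "y \<in> carrier_vec n"
  defines "s \<equiv> sqrt (state_potential (v, y))"
  shows "l2_norm (y - sol) \<le> s" "\<alpha> * l2_norm (v - sol) \<le> s" "l2_norm (v - sol) \<le> \<kappa> * s"
proof -
  let ?l = "l2_norm (lift (v - sol))"
  have vs: "v - sol \<in> carrier_vec n"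
    using assms by auto
  show "l2_norm (y - sol) \<le> s"
    unfolding s_def by (rule real_le_rsqrt) (simp add: state_potential_def potential_def)
  have l: "\<sigma> * ?l \<le> s"
    unfolding s_def by (rule real_le_rsqrt) (simp add: state_potential_def potential_def power_mult_distrib)
  have lF: "l2_norm (v - sol) \<le> F * ?l"
    by (rule l2_norm_le_fro_lift[OF vs])
  have "F \<le> \<kappa> * \<sigma>"
    using fro_over_sigma_le_cond sigma_pos by (simp add: field_simps)
  then have "F * ?l \<le> \<kappa> * \<sigma> * ?l"
    by (intro mult_right_mono) auto
  also have "\<dots> \<le> \<kappa> * s"
    using l cond_ge_1 by (simp add: mult.assoc mult_left_mono)
  finally show "l2_norm (v - sol) \<le> \<kappa> * s"
    using lF by linarith
  have "\<alpha> \<le> \<theta>"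
    unfolding ark_alpha_eq using theta_pos by (simp add: field_simps)
  then have "\<alpha> * l2_norm (v - sol) \<le> \<theta> * (F * ?l)"
    using lF theta_pos by (intro mult_mono) auto
  also have "\<dots> = \<sigma> * ((F * sqrt dmin) / S) * ?l"
    by (simp add: \<theta>_def)
  also have "\<dots> \<le> \<sigma> * 1 * ?l"
    using fro_sqrt_dmin_le_S S_pos sigma_pos by (intro mult_right_mono mult_left_mono) auto
  finally show "\<alpha> * l2_norm (v - sol) \<le> s"
    using l by simp
qed

lemma bounded_state_potential:
  assumes "v \<in> fp_vectors" "y \<in> fp_vectors"
  shows "bounded_state (l2_norm sol + sqrt (state_potential (v, y))) v y"
proof -
  note c [simp] = assms[THEN fp_vectors_carrier]
  let ?s = "sqrt (state_potential (v, y))"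
  have split: "l2_norm z \<le> l2_norm (z - sol) + l2_norm sol" if "z \<in> carrier_vec n" for z
  proof -
    have "z = (z - sol) + sol"
      using that by (intro eq_vecI) (auto simp: carrier_vecD[OF sol_carrier])
    then show ?thesis
      using l2_norm_triangle[of "z - sol" n sol] that by simp
  qed
  have a1: "\<alpha> \<le> 1"
    unfolding ark_alpha_eq using theta_pos by simp
  have s: "0 \<le> ?s" by (simp add: state_potential_nonneg)
  have "\<alpha> * l2_norm v \<le> \<alpha> * (l2_norm (v - sol) + l2_norm sol)"
    using split[OF c(1)] params_bounds by (intro mult_left_mono) auto
  also have "\<dots> \<le> ?s + l2_norm sol"
    using state_bounds(2)[OF c] a1 params_bounds mult_left_le_one_le[of "l2_norm sol" \<alpha>]
    by (simp add: distrib_left)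
  finally have 1: "\<alpha> * l2_norm v \<le> l2_norm sol + ?s" by simp
  have "l2_norm v \<le> \<kappa> * ?s + 1 * l2_norm sol"
    using split[OF c(1)] state_bounds(3)[OF c] by simp
  also have "1 * l2_norm sol \<le> \<kappa> * l2_norm sol"
    using cond_ge_1 by (intro mult_right_mono) auto
  finally have 2: "l2_norm v \<le> \<kappa> * (l2_norm sol + ?s)"
    by (simp add: distrib_left)
  show ?thesis
    unfolding bounded_state_def using assms 1 2 split[OF c(2)] state_bounds(1)[OF c] s by auto
qed

lemma computed_step_potential_le:
  assumes fp: "v \<in> fp_vectors" "y \<in> fp_vectors" and i: "i < n" and e: "0 < e"
  shows "state_potential (fp_ark_step M A b lam \<mu> \<nu> i (v, y))
    \<le> (1 + e) * potential ((exact_q v y - sol) - \<gamma> \<cdot>\<^sub>v (coeff i (exact_x v y - sol) \<cdot>\<^sub>v row A i))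
                            ((exact_x v y - sol) - coeff i (exact_x v y - sol) \<cdot>\<^sub>v row A i)
      + (1 + 1 / e) * (36000000 * (\<eta> * \<kappa>)\<^sup>2 * ((l2_norm sol)\<^sup>2 + state_potential (v, y)))"
proof -
  note c [simp] = fp[THEN fp_vectors_carrier]
  let ?P = "state_potential (v, y)"
  define R where "R = l2_norm sol + sqrt ?P"
  have bs: "bounded_state R v y"
    unfolding R_def by (rule bounded_state_potential[OF fp])
  define st where "st = fp_ark_step M A b lam \<mu> \<nu> i (v, y)"
  define ev where "ev = fst st - (exact_q v y - \<gamma> \<cdot>\<^sub>v exact_w i v y)"
  define ey where "ey = snd st - (exact_x v y - exact_w i v y)"
  have stc: "fst st \<in> carrier_vec n" "snd st \<in> carrier_vec n"
    unfolding st_def using fp_step_closed[OF bs i] fp_vectors_carrier by auto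
  have ec: "ev \<in> carrier_vec n" "ey \<in> carrier_vec n"
    using stc by (auto simp: ev_def ey_def)
  have R0: "0 \<le> \<eta> * \<kappa> * R"
    using R_nonneg[OF bs] eta cond_ge_1 by (intro mult_nonneg_nonneg) auto
  have "l2_norm ev \<le> 3000 * (\<eta> * \<kappa> * R)" "l2_norm ey \<le> 3000 * (\<eta> * \<kappa> * R)"
    using fp_step_v_error[OF bs i] fp_step_y_error[OF bs i] kappa_eta_R(1)[OF bs] R0
    unfolding ev_def ey_def st_def by linarith+
  then have "(l2_norm ev)\<^sup>2 \<le> (3000 * (\<eta> * \<kappa> * R))\<^sup>2" "(l2_norm ey)\<^sup>2 \<le> (3000 * (\<eta> * \<kappa> * R))\<^sup>2"
    by (intro power_mono; simp)+
  then have "(l2_norm ev)\<^sup>2 + (l2_norm ey)\<^sup>2 \<le> 18000000 * (\<eta> * \<kappa>)\<^sup>2 * R\<^sup>2"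
    by (simp add: power_mult_distrib)
  also have "\<dots> \<le> 18000000 * (\<eta> * \<kappa>)\<^sup>2 * (2 * ((l2_norm sol)\<^sup>2 + ?P))"
  proof (intro mult_left_mono)
    have "R\<^sup>2 \<le> 2 * ((l2_norm sol)\<^sup>2 + (sqrt ?P)\<^sup>2)"
      unfolding R_def using zero_le_power2[of "l2_norm sol - sqrt ?P"]
      unfolding power2_sum power2_diff by argo
    then show "R\<^sup>2 \<le> 2 * ((l2_norm sol)\<^sup>2 + ?P)"
      by (simp add: state_potential_nonneg)
  qed auto
  finally have err: "(l2_norm ev)\<^sup>2 + (l2_norm ey)\<^sup>2
      \<le> 36000000 * (\<eta> * \<kappa>)\<^sup>2 * ((l2_norm sol)\<^sup>2 + ?P)"
    by (simp add: algebra_simps)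
  let ?x = "exact_x v y - sol" and ?q = "exact_q v y - sol"
  let ?w = "coeff i ?x \<cdot>\<^sub>v row A i"
  have qc: "?q - \<gamma> \<cdot>\<^sub>v ?w \<in> carrier_vec n" "?x - ?w \<in> carrier_vec n"
    by auto
  have "fst st - sol = (?q - \<gamma> \<cdot>\<^sub>v ?w) + ev"
    unfolding ev_def exact_w_def using stc
    by (intro eq_vecI) (auto simp: carrier_vecD[OF sol_carrier] carrier_vecD[OF exact_carrier(2)[OF c]])
  moreover have "snd st - sol = (?x - ?w) + ey"
    unfolding ey_def exact_w_def using stc
    by (intro eq_vecI) (auto simp: carrier_vecD[OF sol_carrier] carrier_vecD[OF exact_carrier(1)[OF c]])
  ultimately have "state_potential st = potential ((?q - \<gamma> \<cdot>\<^sub>v ?w) + ev) ((?x - ?w) + ey)"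
    by (simp add: state_potential_def)
  also have "\<dots> \<le> (1 + e) * potential (?q - \<gamma> \<cdot>\<^sub>v ?w) (?x - ?w)
      + (1 + 1 / e) * ((l2_norm ev)\<^sup>2 + (l2_norm ey)\<^sup>2)"
    by (rule potential_add_le[OF qc ec e])
  also have "(1 + 1 / e) * ((l2_norm ev)\<^sup>2 + (l2_norm ey)\<^sup>2)
      \<le> (1 + 1 / e) * (36000000 * (\<eta> * \<kappa>)\<^sup>2 * ((l2_norm sol)\<^sup>2 + ?P))"
    using err e by (intro mult_left_mono) auto
  finally show ?thesis
    by (simp add: st_def)
qed

definition \<rho> :: real where "\<rho> = 1 / (2 * \<kappa> * sqrt (real n))"

lemma rho: "0 < \<rho>" "\<rho> \<le> \<theta>" "\<rho> \<le> 1 / 2"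
proof -
  have "1 \<le> sqrt (real n)"
    using n_pos by simp
  then have k: "1 * 1 \<le> \<kappa> * sqrt (real n)"
    using cond_ge_1 by (intro mult_mono) auto
  then show "0 < \<rho>" unfolding \<rho>_def by simp
  show "\<rho> \<le> \<theta>" unfolding \<rho>_def by (rule theta_ge[OF option])
  have "1 / (2 * (\<kappa> * sqrt (real n))) \<le> 1 / 2"
    using k by (intro divide_left_mono) auto
  then show "\<rho> \<le> 1 / 2"
    by (simp add: \<rho>_def mult.assoc)
qed

text \<open>An upper bound for the factor \<open>(1 + 1 / e) * 36000000 (\<eta> \<kappa>)\<^sup>2\<close> in \<open>computed_step_potential_le\<close>
  with \<open>e = \<rho> / 4\<close>, since then \<open>1 + 1 / e \<le> 5 / \<rho>\<close>.\<close>

definition noise :: real where "noise = 180000000 * (\<eta> * \<kappa>)\<^sup>2 / \<rho>"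

lemma noise_bounds: "0 \<le> noise" "2 / \<rho> * noise \<le> (38000 * (real n)\<^sup>2 * \<kappa>\<^sup>2 * u)\<^sup>2" "noise \<le> \<rho> / 4"
proof -
  show "0 \<le> noise"
    using rho by (simp add: noise_def)
  have inv: "1 / \<rho>\<^sup>2 = 4 * \<kappa>\<^sup>2 * real n"
    by (simp add: \<rho>_def power_mult_distrib power_divide)
  have "2 / \<rho> * noise = 360000000 * (\<eta> * \<kappa>)\<^sup>2 * (1 / \<rho>\<^sup>2)"
    by (simp add: noise_def power2_eq_square)
  also have "\<dots> = 1440000000 * (real n ^ 3 * (\<kappa>\<^sup>2 * u)\<^sup>2)"
    unfolding inv by (simp add: \<eta>_def power2_eq_square power3_eq_cube)
  also have "\<dots> \<le> 1440000000 * (real n ^ 4 * (\<kappa>\<^sup>2 * u)\<^sup>2)"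
    using n_pos by (intro mult_left_mono mult_right_mono power_increasing) auto
  finally have le: "2 / \<rho> * noise \<le> 1440000000 * (real n ^ 4 * (\<kappa>\<^sup>2 * u)\<^sup>2)" .
  also have "\<dots> \<le> 1444000000 * (real n ^ 4 * (\<kappa>\<^sup>2 * u)\<^sup>2)"
    by (intro mult_right_mono) auto
  also have "\<dots> = (38000 * (real n)\<^sup>2 * \<kappa>\<^sup>2 * u)\<^sup>2"
    by (simp add: power_mult_distrib flip: power_mult)
  finally show "2 / \<rho> * noise \<le> (38000 * (real n)\<^sup>2 * \<kappa>\<^sup>2 * u)\<^sup>2" .
  have "(real n)\<^sup>2 * (\<kappa>\<^sup>2 * u) \<le> (real n)\<^sup>2 * (1 / (60000 * (real n)\<^sup>2))"
    using small_cond by (intro mult_left_mono) auto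
  also have "\<dots> = 1 / 60000"
    using n_pos by simp
  finally have "((real n)\<^sup>2 * (\<kappa>\<^sup>2 * u))\<^sup>2 \<le> (1 / 60000)\<^sup>2"
    using u_pos by (intro power_mono) auto
  then have "real n ^ 4 * (\<kappa>\<^sup>2 * u)\<^sup>2 \<le> 1 / 3600000000"
    by (simp add: power_mult_distrib power_divide flip: power_mult)
  with le have "2 / \<rho> * noise \<le> 1 / 2"
    by linarith
  then show "noise \<le> \<rho> / 4"
    using rho by (simp add: field_simps)
qed

text \<open>Of the contraction gap \<open>\<rho>\<close>, a quarter is spent on the weight \<open>1 + e\<close> and a quarter on the
  rounding errors that are proportional to the potential.\<close>

lemma mean_computed_step:
  assumes fp: "v \<in> fp_vectors" "y \<in> fp_vectors"
  shows "(\<Sum>i<n. d i / S * state_potential (fp_ark_step M A b lam \<mu> \<nu> i (v, y)))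
    \<le> (1 - \<rho> / 2) * state_potential (v, y) + noise * (l2_norm sol)\<^sup>2"
proof -
  note c [simp] = fp[THEN fp_vectors_carrier]
  let ?P = "state_potential (v, y)"
  let ?x = "exact_x v y - sol" and ?q = "exact_q v y - sol"
  define p where "p i = potential (?q - \<gamma> \<cdot>\<^sub>v (coeff i ?x \<cdot>\<^sub>v row A i)) (?x - coeff i ?x \<cdot>\<^sub>v row A i)" for i
  define e where "e = \<rho> / 4"
  define K where "K = (1 + 1 / e) * (36000000 * (\<eta> * \<kappa>)\<^sup>2 * ((l2_norm sol)\<^sup>2 + ?P))"
  have e: "0 < e"
    using rho by (simp add: e_def)
  have w: "0 \<le> d i / S" if "i < n" for i
    using d_pos[OF that] S_pos by simp
  have "(\<Sum>i<n. d i / S * state_potential (fp_ark_step M A b lam \<mu> \<nu> i (v, y)))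
      \<le> (\<Sum>i<n. d i / S * ((1 + e) * p i + K))"
    using computed_step_potential_le[OF fp _ e] w unfolding p_def K_def
    by (intro sum_mono mult_left_mono) auto
  also have "\<dots> = (1 + e) * (\<Sum>i<n. d i / S * p i) + K"
  proof -
    have "(\<Sum>i<n. d i / S * K) = K"
      using S_pos by (simp only: sum_distrib_right[symmetric] sum_divide_distrib[symmetric] sum_d) simp
    moreover have "d i / S * ((1 + e) * p i + K) = (1 + e) * (d i / S * p i) + d i / S * K" for i
      by (simp only: distrib_left mult.left_commute[of "d i / S" "1 + e"])
    ultimately show ?thesis
      by (simp only: sum.distrib sum_distrib_left[symmetric])
  qed
  also have "(\<Sum>i<n. d i / S * p i) \<le> (1 - \<theta>) * ?P"
    unfolding p_def state_potential_def fst_conv snd_conv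
  proof (rule mean_potential_step)
    show "?x = \<alpha> \<cdot>\<^sub>v (v - sol) + (1 - \<alpha>) \<cdot>\<^sub>v (y - sol)"
      unfolding exact_x_def
      by (intro eq_vecI) (auto simp: carrier_vecD[OF sol_carrier] carrier_vecD[OF c(1)]
          carrier_vecD[OF c(2)] algebra_simps)
    show "?q = \<beta> \<cdot>\<^sub>v (v - sol) + (1 - \<beta>) \<cdot>\<^sub>v (exact_x v y - sol)"
      unfolding exact_q_def
      by (intro eq_vecI) (auto simp: carrier_vecD[OF sol_carrier] carrier_vecD[OF c(1)]
          carrier_vecD[OF exact_carrier(1)[OF c]] algebra_simps)
  qed auto
  also have "(1 + e) * ((1 - \<theta>) * ?P) + K \<le> (1 - 3 / 4 * \<rho>) * ?P + noise * ((l2_norm sol)\<^sup>2 + ?P)"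
  proof (rule add_mono)
    have "(1 + e) * (1 - \<theta>) \<le> (1 + e) * (1 - \<rho>)"
      using rho e by (intro mult_left_mono) auto
    also have "\<dots> = 1 - 3 / 4 * \<rho> - \<rho>\<^sup>2 / 4"
      by (simp add: e_def field_simps power2_eq_square)
    also have "\<dots> \<le> 1 - 3 / 4 * \<rho>"
      by simp
    finally show "(1 + e) * ((1 - \<theta>) * ?P) \<le> (1 - 3 / 4 * \<rho>) * ?P"
      using mult_right_mono[of _ _ ?P] state_potential_nonneg by (simp add: mult.assoc[symmetric])
    have "1 + 1 / e \<le> 5 / \<rho>"
      using rho by (simp add: e_def field_simps)
    then have "K \<le> 5 / \<rho> * (36000000 * (\<eta> * \<kappa>)\<^sup>2 * ((l2_norm sol)\<^sup>2 + ?P))"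
      unfolding K_def using state_potential_nonneg by (intro mult_right_mono) auto
    then show "K \<le> noise * ((l2_norm sol)\<^sup>2 + ?P)"
      by (simp add: noise_def)
  qed
  also have "\<dots> = (1 - 3 / 4 * \<rho>) * ?P + noise * ?P + noise * (l2_norm sol)\<^sup>2"
    by (simp add: algebra_simps)
  also have "noise * ?P \<le> \<rho> / 4 * ?P"
    using noise_bounds(3) state_potential_nonneg by (intro mult_right_mono) auto
  also have "(1 - 3 / 4 * \<rho>) * ?P + \<rho> / 4 * ?P = (1 - \<rho> / 2) * ?P"
    by (simp add: algebra_simps)
  finally show ?thesis
    using e by simp
qed

section \<open>Error of the computed iterates\<close>

abbreviation "state \<equiv> fp_ark_state M A b lam \<mu> \<nu>"

lemma pmf_row: "pmf (ark_row_pmf A lam) i = (if i < n then d i / S else 0)"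
  using pmf_ark_row_pmf[of lam A i] lam_nonneg S_pos by (simp add: S_def d_def)

lemma set_row_pmf: "set_pmf (ark_row_pmf A lam) \<subseteq> {..<n}"
  by (auto simp: set_pmf_iff pmf_row split: if_splits)

lemma state_support: "finite (set_pmf (state k))" "set_pmf (state k) \<subseteq> fp_vectors \<times> fp_vectors"
proof (induction k)
  case 0
  show "finite (set_pmf (state 0))" "set_pmf (state 0) \<subseteq> fp_vectors \<times> fp_vectors"
    by (auto simp: zero_fp_vectors)
next
  case (Suc k)
  show "finite (set_pmf (state (Suc k)))"
    using Suc finite_subset[OF set_row_pmf] by simp
  show "set_pmf (state (Suc k)) \<subseteq> fp_vectors \<times> fp_vectors"
  proof
    fix s assume "s \<in> set_pmf (state (Suc k))"
    then obtain v y i where vy: "(v, y) \<in> set_pmf (state k)" and i: "i \<in> set_pmf (ark_row_pmf A lam)"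
      and s: "s = fp_ark_step M A b lam \<mu> \<nu> i (v, y)"
      by auto
    have "v \<in> fp_vectors" "y \<in> fp_vectors" "i < n"
      using vy Suc i set_row_pmf by auto
    then show "s \<in> fp_vectors \<times> fp_vectors"
      using fp_step_closed[OF bounded_state_potential] by (simp add: s mem_Times_iff)
  qed
qed

lemma expectation_step:
  fixes f :: "real vec \<times> real vec \<Rightarrow> real"
  shows "measure_pmf.expectation (state (Suc k)) f =
    measure_pmf.expectation (state k) (\<lambda>s. \<Sum>i<n. d i / S * f (fp_ark_step M A b lam \<mu> \<nu> i s))"
proof -
  have fin: "finite (set_pmf (ark_row_pmf A lam))"
    by (rule finite_subset[OF set_row_pmf]) simp
  have inner: "measure_pmf.expectation (map_pmf (\<lambda>i. fp_ark_step M A b lam \<mu> \<nu> i s) (ark_row_pmf A lam)) f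
      = (\<Sum>i<n. d i / S * f (fp_ark_step M A b lam \<mu> \<nu> i s))" for s
    unfolding integral_map_pmf
    by (subst integral_measure_pmf[of "{..<n}"]) (use set_row_pmf in \<open>auto simp: pmf_row\<close>)
  have "measure_pmf.expectation (state (Suc k)) f = (\<Sum>s\<in>set_pmf (state k). pmf (state k) s *\<^sub>R
      measure_pmf.expectation (map_pmf (\<lambda>i. fp_ark_step M A b lam \<mu> \<nu> i s) (ark_row_pmf A lam)) f)"
    unfolding fp_ark_state.simps by (rule pmf_expectation_bind) (use state_support fin in auto)
  also have "\<dots> = measure_pmf.expectation (state k) (\<lambda>s. \<Sum>i<n. d i / S * f (fp_ark_step M A b lam \<mu> \<nu> i s))"
    unfolding inner by (rule integral_measure_pmf[symmetric]) (use state_support in auto)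
  finally show ?thesis .
qed

lemma integrable_state: "integrable (measure_pmf (state k)) (f :: _ \<Rightarrow> real)"
  by (rule integrable_measure_pmf_finite) (rule state_support)

lemma initial_potential: "state_potential (0\<^sub>v n, 0\<^sub>v n) \<le> 2 * (l2_norm sol)\<^sup>2"
proof -
  have c: "0\<^sub>v n - sol \<in> carrier_vec n" and eq: "0\<^sub>v n - sol = - sol"
    by (auto intro!: eq_vecI)
  have "(\<sigma> * l2_norm (lift (0\<^sub>v n - sol)))\<^sup>2 \<le> (l2_norm (0\<^sub>v n - sol))\<^sup>2"
    using sigma_lift_le[OF c] sigma_pos by (intro power_mono) auto
  then show ?thesis
    by (simp add: state_potential_def potential_def power_mult_distrib eq)
qed

text \<open>The geometric series of the noise sums to \<open>2 / \<rho>\<close> times its value.\<close>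

lemma expected_potential_le:
  "measure_pmf.expectation (state k) state_potential
    \<le> ((1 - \<rho> / 2) ^ k * 2 + 2 / \<rho> * noise) * (l2_norm sol)\<^sup>2"
proof (induction k)
  case 0
  have "0 \<le> 2 / \<rho> * noise * (l2_norm sol)\<^sup>2"
    using rho noise_bounds(1) by (intro mult_nonneg_nonneg) auto
  then show ?case
    using initial_potential by (simp add: distrib_right)
next
  case (Suc k)
  let ?E = "measure_pmf.expectation (state k)"
  have "measure_pmf.expectation (state (Suc k)) state_potential
      \<le> ?E (\<lambda>s. (1 - \<rho> / 2) * state_potential s + noise * (l2_norm sol)\<^sup>2)"
    unfolding expectation_step
  proof (rule integral_mono_AE[OF integrable_state integrable_state])
    show "AE s in measure_pmf (state k).
        (\<Sum>i<n. d i / S * state_potential (fp_ark_step M A b lam \<mu> \<nu> i s))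
        \<le> (1 - \<rho> / 2) * state_potential s + noise * (l2_norm sol)\<^sup>2"
      using state_support(2)[of k] mean_computed_step by (auto simp: AE_measure_pmf_iff)
  qed
  also have "\<dots> = (1 - \<rho> / 2) * ?E state_potential + noise * (l2_norm sol)\<^sup>2"
    using integrable_state[of k] by simp
  also have "\<dots> \<le> (1 - \<rho> / 2) * (((1 - \<rho> / 2) ^ k * 2 + 2 / \<rho> * noise) * (l2_norm sol)\<^sup>2)
      + noise * (l2_norm sol)\<^sup>2"
    using Suc rho by (intro add_right_mono mult_left_mono) auto
  also have "\<dots> = ((1 - \<rho> / 2) ^ Suc k * 2 + 2 / \<rho> * noise) * (l2_norm sol)\<^sup>2"
    using rho(1) by (simp add: field_simps)
  finally show ?case .
qed

lemma output_error_le: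
  assumes fp: "v \<in> fp_vectors" "y \<in> fp_vectors"
  shows "l2_norm (fp_ark_x M \<mu> \<nu> (v, y) - sol) \<le> 3 * sqrt (state_potential (v, y)) + 6 * u * l2_norm sol"
proof -
  note c [simp] = fp[THEN fp_vectors_carrier]
  let ?s = "sqrt (state_potential (v, y))"
  let ?x = "fp_ark_x M \<mu> \<nu> (v, y)"
  have bs: "bounded_state (l2_norm sol + ?s) v y"
    by (rule bounded_state_potential[OF fp])
  note xc = xc_carrier[OF bs]
  have "exact_x v y - sol = \<alpha> \<cdot>\<^sub>v (v - sol) + (1 - \<alpha>) \<cdot>\<^sub>v (y - sol)"
    unfolding exact_x_def
    by (intro eq_vecI) (auto simp: carrier_vecD[OF sol_carrier] carrier_vecD[OF c(1)]
        carrier_vecD[OF c(2)] algebra_simps)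
  then have "l2_norm (exact_x v y - sol) \<le> \<alpha> * l2_norm (v - sol) + (1 - \<alpha>) * l2_norm (y - sol)"
    using l2_norm_triangle[of "\<alpha> \<cdot>\<^sub>v (v - sol)" n "(1 - \<alpha>) \<cdot>\<^sub>v (y - sol)"] params_bounds by simp
  also have "(1 - \<alpha>) * l2_norm (y - sol) \<le> l2_norm (y - sol)"
    using params_bounds by (intro mult_left_le_one_le) auto
  finally have 1: "l2_norm (exact_x v y - sol) \<le> 2 * ?s"
    using state_bounds(1,2)[OF c] by linarith
  have "?x - sol = (?x - exact_x v y) + (exact_x v y - sol)"
    by (intro eq_vecI) (auto simp: carrier_vecD[OF sol_carrier] carrier_vecD[OF xc]
        carrier_vecD[OF exact_carrier(1)[OF c]])
  then have "l2_norm (?x - sol) \<le> 6 * u * (l2_norm sol + ?s) + 2 * ?s"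
    using l2_norm_triangle[of "?x - exact_x v y" n "exact_x v y - sol"] fp_x_error[OF bs] 1 xc by simp
  moreover have "6 * u * ?s \<le> 1 * ?s"
    using eta by (intro mult_right_mono) (auto simp: state_potential_nonneg)
  ultimately show ?thesis
    by (simp add: distrib_left)
qed

text \<open>Jensen's inequality for the square root, read off from nonnegativity of the variance.\<close>

lemma expectation_sqrt_le:
  assumes "\<And>s. 0 \<le> f s"
  shows "measure_pmf.expectation (state k) (\<lambda>s. sqrt (f s)) \<le> sqrt (measure_pmf.expectation (state k) f)"
proof (rule real_le_rsqrt)
  have "0 \<le> measure_pmf.variance (state k) (\<lambda>s. sqrt (f s))"
    by (rule measure_pmf.variance_positive)
  also have "\<dots> = measure_pmf.expectation (state k) f
      - (measure_pmf.expectation (state k) (\<lambda>s. sqrt (f s)))\<^sup>2"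
    by (subst measure_pmf.variance_eq) (use integrable_state assms in auto)
  finally show "(measure_pmf.expectation (state k) (\<lambda>s. sqrt (f s)))\<^sup>2 \<le> measure_pmf.expectation (state k) f"
    by simp
qed

lemma ark_error_le:
  "ark_error M A b lam k
    \<le> (1 - 1 / (4 * \<kappa> * sqrt (real n))) powr (real k / 4) * 6 * l2_norm sol
      + 114006 * (real n)\<^sup>2 * l2_norm sol * \<kappa>\<^sup>2 * u"
proof -
  let ?E = "measure_pmf.expectation (state k)"
  let ?g = "1 - \<rho> / 2"
  have g: "0 < ?g" "?g \<le> 1"
    using rho by auto
  have "ark_error M A b lam k = ?E (\<lambda>s. l2_norm (fp_ark_x M \<mu> \<nu> s - sol))"
    by (simp add: ark_error_def fp_ark_output_def sol_def)
  also have "\<dots> \<le> ?E (\<lambda>s. 3 * sqrt (state_potential s) + 6 * u * l2_norm sol)"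
    by (rule integral_mono_AE[OF integrable_state integrable_state])
      (use state_support(2)[of k] output_error_le in \<open>auto simp: AE_measure_pmf_iff\<close>)
  also have "\<dots> = 3 * ?E (\<lambda>s. sqrt (state_potential s)) + 6 * u * l2_norm sol"
    using integrable_state[of k] by simp
  also have "?E (\<lambda>s. sqrt (state_potential s))
      \<le> sqrt (((?g ^ k * 2 + 2 / \<rho> * noise)) * (l2_norm sol)\<^sup>2)"
    using expectation_sqrt_le[of state_potential k] expected_potential_le[of k] state_potential_nonneg
    by (meson order_trans real_sqrt_le_mono)
  also have "\<dots> = sqrt (?g ^ k * 2 + 2 / \<rho> * noise) * l2_norm sol"
    by (simp add: real_sqrt_mult)
  also have "sqrt (?g ^ k * 2 + 2 / \<rho> * noise) \<le> sqrt (?g ^ k * 2) + sqrt (2 / \<rho> * noise)"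
    using g rho noise_bounds(1) by (intro sqrt_add_le_add_sqrt) auto
  also have "sqrt (2 / \<rho> * noise) \<le> 38000 * (real n)\<^sup>2 * \<kappa>\<^sup>2 * u"
    using noise_bounds(2) u_pos by (intro real_le_lsqrt) auto
  also have "sqrt (?g ^ k * 2) \<le> ?g powr (real k / 4) * 2"
  proof -
    have "sqrt (?g ^ k * 2) = ?g powr (real k / 2) * sqrt 2"
      using g by (simp add: real_sqrt_mult powr_half_sqrt[symmetric] powr_powr flip: powr_realpow)
    also have "\<dots> \<le> ?g powr (real k / 4) * 2"
      using g by (intro mult_mono powr_mono') (auto simp: real_le_lsqrt)
    finally show ?thesis .
  qed
  finally have "ark_error M A b lam k
      \<le> 3 * ((?g powr (real k / 4) * 2 + 38000 * (real n)\<^sup>2 * \<kappa>\<^sup>2 * u) * l2_norm sol)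
        + 6 * u * l2_norm sol"
    by (simp add: mult_right_mono add_mono)
  also have "\<dots> = ?g powr (real k / 4) * 6 * l2_norm sol
      + 114000 * ((real n)\<^sup>2 * \<kappa>\<^sup>2 * u * l2_norm sol) + 6 * (u * l2_norm sol)"
    by (simp add: algebra_simps)
  also have "u * l2_norm sol \<le> (real n)\<^sup>2 * \<kappa>\<^sup>2 * u * l2_norm sol"
  proof -
    have "1 \<le> (real n)\<^sup>2 * \<kappa>\<^sup>2"
      using n_pos cond_ge_1 mult_mono[of 1 "(real n)\<^sup>2" 1 "\<kappa>\<^sup>2"] by (simp add: one_le_power)
    then show ?thesis
      using mult_right_mono[of 1 "(real n)\<^sup>2 * \<kappa>\<^sup>2" "u * l2_norm sol"] u_pos by (simp add: mult_ac)
  qed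
  also have "?g = 1 - 1 / (4 * \<kappa> * sqrt (real n))"
    by (simp add: \<rho>_def)
  finally show ?thesis
    by (simp add: mult_ac)
qed

end

definition ark_iterations :: "nat \<Rightarrow> real \<Rightarrow> real \<Rightarrow> nat" where
  "ark_iterations n k u = nat \<lceil>16 * k * sqrt (real n) * ln (1 / u)\<rceil>"

text \<open>After \<open>t\<close> iterations the geometric term is at most \<open>exp (- t / (16 k sqrt n))\<close>, which explains
  the factor 16; the additional 1 in 17 pays for rounding up, as \<open>k sqrt n ln (1 / u)\<close> is at least 1.\<close>

lemma ark_iterations_bounds:
  fixes k u :: real
  assumes k: "1 \<le> k * sqrt (real n)" and u: "0 < u" "u \<le> 1 / 3"
  shows "real (ark_iterations n k u) \<le> 17 * k * sqrt (real n) * ln (1 / u)"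
    and "(1 - 1 / (4 * k * sqrt (real n))) powr (real (ark_iterations n k u) / 4) \<le> u"
proof -
  define X where "X = k * sqrt (real n)"
  define L where "L = ln (1 / u)"
  define N where "N = real (ark_iterations n k u)"
  have X: "1 \<le> X" using k by (simp add: X_def)
  have "exp 1 \<le> (3 :: real)"
    by (rule exp_le)
  also have "3 \<le> 1 / u"
    using u by (simp add: field_simps)
  finally have "exp 1 \<le> 1 / u" .
  then have L: "1 \<le> L"
    using u by (simp add: L_def ln_ge_iff)
  have XL: "1 \<le> X * L"
    using mult_mono[OF X L] X by simp
  have N_eq: "N = real (nat \<lceil>16 * (X * L)\<rceil>)"
    by (simp add: N_def ark_iterations_def X_def L_def mult.assoc)
  have N: "16 * (X * L) \<le> N" "N \<le> 16 * (X * L) + 1"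
    unfolding N_eq using XL by linarith+
  show "real (ark_iterations n k u) \<le> 17 * k * sqrt (real n) * ln (1 / u)"
    using N(2) XL by (simp add: N_def X_def L_def mult.assoc)
  have "(1 - 1 / (4 * X)) powr (N / 4) \<le> exp (- (1 / (4 * X))) powr (N / 4)"
    using X exp_ge_add_one_self[of "- (1 / (4 * X))"] N XL by (intro powr_mono2) auto
  also have "\<dots> = exp (- (N / (16 * X)))"
    by (simp add: powr_def)
  also have "\<dots> \<le> exp (- L)"
    using N(1) X by (simp add: field_simps)
  also have "\<dots> = u"
    using u by (simp add: L_def ln_div)
  finally show "(1 - 1 / (4 * k * sqrt (real n))) powr (real (ark_iterations n k u) / 4) \<le> u"
    by (simp add: X_def N_def mult.assoc)
qed

theorem theorem4p2:
  shows "\<exists>(c::real) (K::real) (C0::real poly) (C::real poly) (C1::real poly)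
      (N :: nat \<Rightarrow> real \<Rightarrow> real \<Rightarrow> nat).
    (\<forall>n::nat. 0 < n \<longrightarrow>
       0 < poly C0 (real n) \<and> 0 < poly C (real n) \<and> 0 < poly C1 (real n)) \<and>
    (\<forall>(n::nat) (A::real mat) (b::real vec) (lam::real) (M::fp_arith) (u::real).
       0 < n \<and> A \<in> carrier_mat n n \<and> invertible_mat A \<and> b \<in> carrier_vec n \<and>
       ark_option A lam \<and>
       standard_model M u \<and>
       ark_data_repr M A b lam (ark_mu A lam) (ark_nu A lam) \<and>
       (demmel_cond A)\<^sup>2 * u \<le> 1 / poly C0 (real n)
       \<longrightarrow>
       (let x = mat_inv A *\<^sub>v b;
            \<kappa> = demmel_cond A
        in
          (\<forall>k::nat. ark_error M A b lam k \<le>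
             (1 - 1 / (4 * \<kappa> * sqrt (real n))) powr (real k / 4) * c * l2_norm x
             + poly C (real n) * l2_norm x * \<kappa>\<^sup>2 * u) \<and>
          real (N n \<kappa> u) \<le> K * \<kappa> * sqrt (real n) * ln (1 / u) \<and>
          ark_error M A b lam (N n \<kappa> u) \<le> poly C1 (real n) * l2_norm x * \<kappa>\<^sup>2 * u))"
proof -
  \<comment> \<open>The coefficient of \<open>C1\<close> exceeds that of \<open>C\<close> by 6 to absorb the geometric term, which at the
    chosen iteration is at most \<open>6 u\<close> times the norm of the solution.\<close>
  define C0 C C1 :: "real poly"
    where "C0 = [:0, 0, 60000:]" and "C = [:0, 0, 114006:]" and "C1 = [:0, 0, 114012:]"
  have poly_eq: "poly C0 (real n) = 60000 * (real n)\<^sup>2" "poly C (real n) = 114006 * (real n)\<^sup>2"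
      "poly C1 (real n) = 114012 * (real n)\<^sup>2" for n
    by (simp_all add: C0_def C_def C1_def power2_eq_square)
  have main: "(\<forall>k. ark_error M A b lam k \<le>
         (1 - 1 / (4 * demmel_cond A * sqrt (real n))) powr (real k / 4) * 6 * l2_norm (mat_inv A *\<^sub>v b)
         + poly C (real n) * l2_norm (mat_inv A *\<^sub>v b) * (demmel_cond A)\<^sup>2 * u) \<and>
       real (ark_iterations n (demmel_cond A) u) \<le> 17 * demmel_cond A * sqrt (real n) * ln (1 / u) \<and>
       ark_error M A b lam (ark_iterations n (demmel_cond A) u)
         \<le> poly C1 (real n) * l2_norm (mat_inv A *\<^sub>v b) * (demmel_cond A)\<^sup>2 * u"
    if n: "0 < n" and A: "A \<in> carrier_mat n n" and inv: "invertible_mat A" and b: "b \<in> carrier_vec n"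
      and opt: "ark_option A lam" and model: "standard_model M u"
      and repr: "ark_data_repr M A b lam (ark_mu A lam) (ark_nu A lam)"
      and small: "(demmel_cond A)\<^sup>2 * u \<le> 1 / poly C0 (real n)"
    for n A b lam M u
  proof -
    have "0 \<le> lam"
      using opt by (auto simp: ark_option_def)
    then interpret kaczmarz A n lam
      using n A inv by unfold_locales
    have u0: "0 < u"
      using model by (simp add: standard_model_def)
    have n1: "1 \<le> real n"
      using n by simp
    have "1 * u \<le> \<kappa>\<^sup>2 * u"
      using cond_ge_1 u0 by (intro mult_right_mono) (auto simp: one_le_power)
    also have "\<dots> \<le> 1 / (60000 * (real n)\<^sup>2)"
      using small by (simp add: poly_eq)
    also have "\<dots> \<le> 1 / 3"
    proof (intro divide_left_mono)
      show "3 \<le> 60000 * (real n)\<^sup>2"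
        using one_le_power[OF n1, of 2] by linarith
    qed (use n in auto)
    finally have u3: "u \<le> 1 / 3"
      by simp
    interpret kaczmarz_fp A n lam M u b
      by unfold_locales (use u3 model b repr opt small in \<open>auto simp: poly_eq\<close>)
    have "1 * 1 \<le> \<kappa> * sqrt (real n)"
      using cond_ge_1 n1 by (intro mult_mono) auto
    then have it: "real (ark_iterations n \<kappa> u) \<le> 17 * \<kappa> * sqrt (real n) * ln (1 / u)"
      "(1 - 1 / (4 * \<kappa> * sqrt (real n))) powr (real (ark_iterations n \<kappa> u) / 4) \<le> u"
      using ark_iterations_bounds[of \<kappa> n u] u0 u3 by auto
    have "(1 - 1 / (4 * \<kappa> * sqrt (real n))) powr (real (ark_iterations n \<kappa> u) / 4) * 6 * l2_norm sol
        \<le> u * 6 * l2_norm sol"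
      using it(2) by (intro mult_right_mono) auto
    also have "\<dots> = 6 * (1 * (u * l2_norm sol))"
      by simp
    also have "\<dots> \<le> 6 * (((real n)\<^sup>2 * \<kappa>\<^sup>2) * (u * l2_norm sol))"
    proof (intro mult_left_mono mult_right_mono)
      show "1 \<le> (real n)\<^sup>2 * \<kappa>\<^sup>2"
        using n1 cond_ge_1 mult_mono[of 1 "(real n)\<^sup>2" 1 "\<kappa>\<^sup>2"] by (simp add: one_le_power)
    qed (use u0 in auto)
    finally have "ark_error M A b lam (ark_iterations n \<kappa> u)
        \<le> poly C1 (real n) * l2_norm sol * \<kappa>\<^sup>2 * u"
      using ark_error_le[of "ark_iterations n \<kappa> u"] by (simp add: poly_eq algebra_simps)
    then show ?thesis
      using ark_error_le it(1) by (simp add: poly_eq sol_def)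
  qed
  have pos: "\<forall>n::nat. 0 < n \<longrightarrow> 0 < poly C0 (real n) \<and> 0 < poly C (real n) \<and> 0 < poly C1 (real n)"
    by (simp add: poly_eq)
  show ?thesis
    unfolding Let_def
    by (intro exI[of _ 6] exI[of _ 17] exI[of _ C0] exI[of _ C] exI[of _ C1]
        exI[of _ ark_iterations] conjI[OF pos] allI impI) (rule main; blast)
qed

end
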